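(* Consider the optimized Stern signature scheme with deterministic commitments, seeds of length $l_{\mathrm{seed}}$ and $R$ rounds (defined in the context; no salt). There is an attack, i.e. an adversary that is given the public key $(\mathbf{H},\mathbf{s})$ and access to the signing oracle (on messages of its choice, not necessarily distinct), that finds the secret key $\mathbf{e}$ (with constant probability) in time $O(2^{l_{\mathrm{seed}}/2})$, doing $O\left(\frac{1}{R}2^{l_{\mathrm{seed}}/2}\right)$ signature queries. The scheme thus preserves at most $\frac{l_{\mathrm{seed}}}{2}$ bits of security. In particular, if seeds of size $l_{\mathrm{seed}}=\lambda$ and deterministic commitments are used in Stern's signature scheme, there is an attack that recovers the secret key in time $O(2^{\lambda/2})$.
   Context: Setting: binary syndrome decoding with Hamming weight $wt$. $S_w\subset\mathbb{F}_2^n$ is the set of vectors of weight $w$, and $\mathrm{Perm}_n$ is the set of permutations of $[n]$, acting on vectors by permuting coordinates. $\lambda$ is the security parameter. Functions, modeled as independent random functions (random oracle model): $E_0:\{0,1\}^{l_{\mathrm{seed}}}\to\{0,1\}^{l_{\mathrm{seed}}}\times\{0,1\}^{l_{\mathrm{seed}}}$, $E_1:\{0,1\}^{l_{\mathrm{seed}}}\to \mathrm{Perm}_n$, $E_2:\{0,1\}^{l_{\mathrm{seed}}}\to\mathbb{F}_2^n$, a hash function $\mathcal{H}_{comm}$ with values in $\{0,1\}^{2\lambda}$ used for commitments, and a random oracle $\mathcal H$ with values in $\{1,2,3\}^R$ used for the Fiat-Shamir challenge. A deterministic commitment to a string $z$ is $\mathcal{H}_{comm}(z)$ (no additional randomness).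 Key generation: $\mathbf{H}\in\mathbb{F}_2^{(n-k)\times n}$ uniform, $\mathbf{e}\in S_w$ uniform, $\mathbf{s}=\mathbf{H}\mathbf{e}$; the secret key is $\mathbf{e}$ and the public key is $(\mathbf{H},\mathbf{s})$. Signing a message $m$: for each round $j\in\{1,\dots,R\}$ pick a fresh uniform $\mathrm{seed}^j\in\{0,1\}^{l_{\mathrm{seed}}}$; let $(\mathrm{seed}^j_\pi,\mathrm{seed}^j_{\mathbf y})=E_0(\mathrm{seed}^j)$, $\pi^j=E_1(\mathrm{seed}^j_\pi)$, $\mathbf{y}^j=(\pi^j)^{-1}(E_2(\mathrm{seed}^j_{\mathbf y}))$, $\mathbf{t}^j=\mathbf{H}\mathbf{y}^j$, $z^j_1=(\pi^j,\mathbf{t}^j)$, $z^j_2=\pi^j(\mathbf{y}^j)$, $z^j_3=\pi^j(\mathbf{y}^j+\mathbf{e})$, and $x^j_i=\mathcal{H}_{comm}(z^j_i)$ for $i\in\{1,2,3\}$. Let $\widetilde{x}=\mathcal{H}_{comm}(x^1_1,x^1_2,x^1_3,\dots,x^R_1,x^R_2,x^R_3)$ and $(c^1,\dots,c^R)=\mathcal{H}(\widetilde{x}\|m)$. The response in round $j$ is: if $c^j=1$, $l^j_1=(\mathrm{seed}^j_{\mathbf y},\pi^j(\mathbf{e}))$; if $c^j=2$, $l^j_2=(\mathrm{seed}^j_\pi,\mathbf{y}^j+\mathbf{e})$; if $c^j=3$, $l^j_3=\mathrm{seed}^j$. The signature is $\sigma(m)=(\widetilde{x},x^1_{c^1},\dots,x^R_{c^R},l^1_{c^1},\dots,l^R_{c^R})$.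 Running time counts signature queries, evaluations of the functions $E_0$, $E_1$, $E_2$, $\mathcal{H}_{comm}$ and $\mathcal{H}$, table lookups and vector/permutation operations as unit cost. A scheme preserves at most $b$ bits of security if there is an adversary, given the public key and access to the signing oracle, with running time counted in this way, that runs in time $O(2^b)$ and breaks the scheme with constant probability. *)

theory Defs
  imports
    "HOL-Probability.Probability"
    "HOL-Combinatorics.Permutations"
    "HOL-Library.Z2"
    "Jordan_Normal_Form.Matrix"
begin

section \<open>Parameters and data\<close>

record params =
  code_length :: nat   \<comment> \<open>\<open>n\<close>\<close>
  code_dim :: nat      \<comment> \<open>\<open>k\<close>\<close>
  weight :: nat        \<comment> \<open>\<open>w\<close>\<close>
  sec_param :: nat     \<comment> \<open>\<open>\<lambda>\<close>\<close>
  seed_length :: nat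
  rounds :: nat        \<comment> \<open>\<open>R\<close>\<close>

definition valid_params :: "params \<Rightarrow> bool" where
  "valid_params pp \<longleftrightarrow>
     code_dim pp \<le> code_length pp \<and> weight pp \<le> code_length pp \<and> 1 \<le> rounds pp"

type_synonym bitstring = "bool list"

text \<open>
  Structured values play two roles: they are what the commitment hash is applied to (a structured
  value stands for its encoding as a string), and they are the contents of the adversary's memory.
\<close>

datatype data =
    DNat nat
  | DBits bitstring
  | DVec "bit Matrix.vec"
  | DMat "bit Matrix.mat"
  | DPerm "nat \<Rightarrow> nat"
  | DTup "data list"

definition bitstrings :: "nat \<Rightarrow> bitstring set" where
  "bitstrings l = {bs. length bs = l}"

definition Perm :: "nat \<Rightarrow> (nat \<Rightarrow> nat) set" where
  "Perm n = {\<pi>. \<pi> permutes {..<n}}"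

definition wt :: "bit Matrix.vec \<Rightarrow> nat" where
  "wt v = card {i. i < dim_vec v \<and> vec_index v i \<noteq> 0}"

definition words_of_weight :: "nat \<Rightarrow> nat \<Rightarrow> bit Matrix.vec set" where
  "words_of_weight n w = {v \<in> carrier_vec n. wt v = w}"

text \<open>The left action of permutations: the entry at position \<open>i\<close> moves to position \<open>\<pi> i\<close>.\<close>

definition act :: "(nat \<Rightarrow> nat) \<Rightarrow> bit Matrix.vec \<Rightarrow> bit Matrix.vec" where
  "act \<pi> v = Matrix.vec (dim_vec v) (\<lambda>i. vec_index v (Hilbert_Choice.inv \<pi> i))"


section \<open>The probability space\<close>

text \<open>
  A random function with a possibly infinite domain: independent uniform values at all arguments
  in \<open>A\<close>. Outside \<open>A\<close> every sample takes the constant value \<open>undefined\<close>, so evaluations there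
  give an adversary no information.
\<close>

definition random_function :: "'a set \<Rightarrow> 'b set \<Rightarrow> ('a \<Rightarrow> 'b) measure" where
  "random_function A B = PiM A (\<lambda>_. uniform_count_measure B)"

text \<open>
  All the randomness: the random oracles, the key, and the seeds of the signer, where
  \<open>fresh (i, j)\<close> is the seed picked in round \<open>j\<close> of the answer to the \<open>i\<close>-th signature query
  (both counted from 0).
\<close>

record world =
  E0 :: "bitstring \<Rightarrow> bitstring \<times> bitstring"
  E1 :: "bitstring \<Rightarrow> nat \<Rightarrow> nat"
  E2 :: "bitstring \<Rightarrow> bit Matrix.vec"
  Hcomm :: "data \<Rightarrow> bitstring"
  Hfs :: "bitstring \<Rightarrow> nat list"
  parity :: "bit Matrix.mat"
  secret :: "bit Matrix.vec"
  fresh :: "nat \<times> nat \<Rightarrow> bitstring"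

type_synonym sample =
  "(bitstring \<Rightarrow> bitstring \<times> bitstring) \<times> (bitstring \<Rightarrow> nat \<Rightarrow> nat) \<times> (bitstring \<Rightarrow> bit Matrix.vec)
   \<times> (data \<Rightarrow> bitstring) \<times> (bitstring \<Rightarrow> nat list)
   \<times> bit Matrix.mat \<times> bit Matrix.vec \<times> (nat \<times> nat \<Rightarrow> bitstring)"

fun world_of :: "sample \<Rightarrow> world" where
  "world_of (e0, e1, e2, hc, hf, M, e, \<rho>) =
     \<lparr>E0 = e0, E1 = e1, E2 = e2, Hcomm = hc, Hfs = hf, parity = M, secret = e, fresh = \<rho>\<rparr>"

definition challenges :: "nat \<Rightarrow> nat list set" where
  "challenges R = {cs. length cs = R \<and> set cs \<subseteq> {1, 2, 3}}"

definition stern_space :: "params \<Rightarrow> sample measure" where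
  "stern_space pp =
     (let n = code_length pp; seeds = bitstrings (seed_length pp) in
      random_function seeds (seeds \<times> seeds)
      \<Otimes>\<^sub>M random_function seeds (Perm n)
      \<Otimes>\<^sub>M random_function seeds (carrier_vec n)
      \<Otimes>\<^sub>M random_function UNIV (bitstrings (2 * sec_param pp))
      \<Otimes>\<^sub>M random_function UNIV (challenges (rounds pp))
      \<Otimes>\<^sub>M uniform_count_measure (carrier_mat (n - code_dim pp) n)
      \<Otimes>\<^sub>M uniform_count_measure (words_of_weight n (weight pp))
      \<Otimes>\<^sub>M random_function UNIV seeds)"


section \<open>The optimized Stern signature scheme with deterministic commitments\<close>

definition syndrome :: "world \<Rightarrow> bit Matrix.vec" where
  "syndrome W = parity W *\<^sub>v secret W"

definition seed_perm :: "world \<Rightarrow> bitstring \<Rightarrow> nat \<Rightarrow> nat" where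
  "seed_perm W sd = E1 W (fst (E0 W sd))"

definition seed_mask :: "world \<Rightarrow> bitstring \<Rightarrow> bit Matrix.vec" where
  "seed_mask W sd = act (Hilbert_Choice.inv (seed_perm W sd)) (E2 W (snd (E0 W sd)))"

text \<open>The values \<open>z_i\<close>, \<open>x_i\<close> and \<open>l_i\<close> of a round with the given seed, for \<open>i \<in> {1, 2, 3}\<close>.\<close>

definition committed :: "world \<Rightarrow> bitstring \<Rightarrow> nat \<Rightarrow> data" where
  "committed W sd i =
     (let \<pi> = seed_perm W sd; y = seed_mask W sd in
      if i = 1 then DTup [DPerm \<pi>, DVec (parity W *\<^sub>v y)]
      else if i = 2 then DVec (act \<pi> y)
      else DVec (act \<pi> (y + secret W)))"

definition commitment :: "world \<Rightarrow> bitstring \<Rightarrow> nat \<Rightarrow> bitstring" where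
  "commitment W sd i = Hcomm W (committed W sd i)"

definition response :: "world \<Rightarrow> bitstring \<Rightarrow> nat \<Rightarrow> data" where
  "response W sd i =
     (if i = 1 then DTup [DBits (snd (E0 W sd)), DVec (act (seed_perm W sd) (secret W))]
      else if i = 2 then DTup [DBits (fst (E0 W sd)), DVec (seed_mask W sd + secret W)]
      else DBits sd)"

text \<open>The signature of \<open>m\<close> when the seeds of the rounds are \<open>sds\<close>.\<close>

definition signature :: "world \<Rightarrow> bitstring list \<Rightarrow> bitstring \<Rightarrow> data" where
  "signature W sds m =
     (let x = Hcomm W (DTup (concat (map (\<lambda>sd. map (\<lambda>i. DBits (commitment W sd i)) [1, 2, 3]) sds)));
          cs = Hfs W (x @ m)
      in DTup [DBits x,
               DTup (map2 (\<lambda>sd c. DBits (commitment W sd c)) sds cs),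
               DTup (map2 (\<lambda>sd c. response W sd c) sds cs)])"


section \<open>Adversaries\<close>

text \<open>
  An adversary is a finite program for a register machine with an associative table. Every
  instruction costs one unit of time. The program is fixed independently of all parameters, its
  only literals are natural numbers, and \<open>H\<close>, \<open>s\<close> and the parameters are inputs in registers; hence
  neither local computation nor advice is free. Registers are dynamically typed; the coercions
  below only make the semantics total.
\<close>

type_synonym reg = nat

datatype instr =
    Const reg nat
  | Copy reg reg
  | Add reg reg reg
  | To_Bits reg reg reg        \<comment> \<open>target, length, number\<close>
  | Append reg reg reg
  | Tuple reg "reg list"
  | Proj reg reg reg           \<comment> \<open>target, tuple, index\<close>
  | Store reg reg              \<comment> \<open>table key, value\<close>
  | Lookup reg reg             \<comment> \<open>target, table key\<close>
  | Vec_Add reg reg reg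
  | Mat_Vec reg reg reg
  | Permute reg reg reg        \<comment> \<open>target, permutation, vector\<close>
  | Perm_Inv reg reg
  | Eval_E0 reg reg
  | Eval_E1 reg reg
  | Eval_E2 reg reg
  | Eval_Hcomm reg reg
  | Eval_Hfs reg reg
  | Sign reg reg               \<comment> \<open>target, message\<close>
  | Jump_Eq reg reg nat
  | Jump_Less reg reg nat
  | Halt reg

type_synonym program = "instr list"

record config =
  pc :: nat
  mem :: "reg \<Rightarrow> data"
  table :: "data \<Rightarrow> data option"
  queries :: nat
  answer :: "data option"

definition as_nat :: "data \<Rightarrow> nat" where
  "as_nat d = (case d of DNat i \<Rightarrow> i | _ \<Rightarrow> 0)"

definition as_bits :: "data \<Rightarrow> bitstring" where
  "as_bits d = (case d of DBits b \<Rightarrow> b | _ \<Rightarrow> [])"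

definition as_vec :: "data \<Rightarrow> bit Matrix.vec" where
  "as_vec d = (case d of DVec v \<Rightarrow> v | _ \<Rightarrow> 0\<^sub>v 0)"

definition as_mat :: "data \<Rightarrow> bit Matrix.mat" where
  "as_mat d = (case d of DMat M \<Rightarrow> M | _ \<Rightarrow> 0\<^sub>m 0 0)"

definition as_perm :: "data \<Rightarrow> nat \<Rightarrow> nat" where
  "as_perm d = (case d of DPerm \<pi> \<Rightarrow> \<pi> | _ \<Rightarrow> id)"

definition as_tup :: "data \<Rightarrow> data list" where
  "as_tup d = (case d of DTup ds \<Rightarrow> ds | _ \<Rightarrow> [])"

definition proj :: "data list \<Rightarrow> nat \<Rightarrow> data" where
  "proj ds i = (if i < length ds then ds ! i else DTup [])"

definition to_bits :: "nat \<Rightarrow> nat \<Rightarrow> bitstring" where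
  "to_bits len i = map (\<lambda>j. odd (i div 2 ^ j)) [0..<len]"

definition assign :: "reg \<Rightarrow> data \<Rightarrow> config \<Rightarrow> config" where
  "assign r d c = c\<lparr>pc := Suc (pc c), mem := (mem c)(r := d)\<rparr>"

definition jump :: "bool \<Rightarrow> nat \<Rightarrow> config \<Rightarrow> config" where
  "jump b l c = c\<lparr>pc := (if b then l else Suc (pc c))\<rparr>"

fun exec :: "params \<Rightarrow> world \<Rightarrow> instr \<Rightarrow> config \<Rightarrow> config" where
  "exec pp W (Const r i) c = assign r (DNat i) c"
| "exec pp W (Copy r a) c = assign r (mem c a) c"
| "exec pp W (Add r a b) c = assign r (DNat (as_nat (mem c a) + as_nat (mem c b))) c"
| "exec pp W (To_Bits r a b) c = assign r (DBits (to_bits (as_nat (mem c a)) (as_nat (mem c b)))) c"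
| "exec pp W (Append r a b) c = assign r (DBits (as_bits (mem c a) @ as_bits (mem c b))) c"
| "exec pp W (Tuple r as) c = assign r (DTup (map (mem c) as)) c"
| "exec pp W (Proj r a b) c = assign r (proj (as_tup (mem c a)) (as_nat (mem c b))) c"
| "exec pp W (Store a b) c = c\<lparr>pc := Suc (pc c), table := (table c)(mem c a \<mapsto> mem c b)\<rparr>"
| "exec pp W (Lookup r a) c =
     assign r (case table c (mem c a) of None \<Rightarrow> DTup [] | Some d \<Rightarrow> d) c"
| "exec pp W (Vec_Add r a b) c = assign r (DVec (as_vec (mem c a) + as_vec (mem c b))) c"
| "exec pp W (Mat_Vec r a b) c = assign r (DVec (as_mat (mem c a) *\<^sub>v as_vec (mem c b))) c"
| "exec pp W (Permute r a b) c = assign r (DVec (act (as_perm (mem c a)) (as_vec (mem c b)))) c"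
| "exec pp W (Perm_Inv r a) c = assign r (DPerm (Hilbert_Choice.inv (as_perm (mem c a)))) c"
| "exec pp W (Eval_E0 r a) c =
     assign r (case E0 W (as_bits (mem c a)) of (u, v) \<Rightarrow> DTup [DBits u, DBits v]) c"
| "exec pp W (Eval_E1 r a) c = assign r (DPerm (E1 W (as_bits (mem c a)))) c"
| "exec pp W (Eval_E2 r a) c = assign r (DVec (E2 W (as_bits (mem c a)))) c"
| "exec pp W (Eval_Hcomm r a) c = assign r (DBits (Hcomm W (mem c a))) c"
| "exec pp W (Eval_Hfs r a) c = assign r (DTup (map DNat (Hfs W (as_bits (mem c a))))) c"
| "exec pp W (Sign r a) c =
     assign r (signature W (map (\<lambda>j. fresh W (queries c, j)) [0..<rounds pp]) (as_bits (mem c a)))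
       (c\<lparr>queries := Suc (queries c)\<rparr>)"
| "exec pp W (Jump_Eq a b l) c = jump (mem c a = mem c b) l c"
| "exec pp W (Jump_Less a b l) c = jump (as_nat (mem c a) < as_nat (mem c b)) l c"
| "exec pp W (Halt a) c = c\<lparr>answer := Some (mem c a)\<rparr>"

definition step :: "params \<Rightarrow> world \<Rightarrow> program \<Rightarrow> config \<Rightarrow> config" where
  "step pp W A c =
     (if answer c \<noteq> None \<or> length A \<le> pc c then c else exec pp W (A ! pc c) c)"

definition inputs :: "params \<Rightarrow> bit Matrix.mat \<Rightarrow> bit Matrix.vec \<Rightarrow> data list" where
  "inputs pp M s =
     [DMat M, DVec s, DNat (code_length pp), DNat (code_dim pp), DNat (weight pp),
      DNat (sec_param pp), DNat (seed_length pp), DNat (rounds pp)]"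

definition start :: "params \<Rightarrow> world \<Rightarrow> config" where
  "start pp W =
     \<lparr>pc = 0, mem = proj (inputs pp (parity W) (syndrome W)), table = Map.empty,
      queries = 0, answer = None\<rparr>"

definition run :: "params \<Rightarrow> world \<Rightarrow> program \<Rightarrow> nat \<Rightarrow> config" where
  "run pp W A t = (step pp W A ^^ t) (start pp W)"


section \<open>Attacks\<close>

definition halts_within :: "params \<Rightarrow> program \<Rightarrow> real \<Rightarrow> bool" where
  "halts_within pp A T \<longleftrightarrow>
     (\<exists>t. real t \<le> T \<and> (\<forall>\<omega> \<in> space (stern_space pp). answer (run pp (world_of \<omega>) A t) \<noteq> None))"

definition queries_at_most :: "params \<Rightarrow> program \<Rightarrow> int \<Rightarrow> bool" where
  "queries_at_most pp A q \<longleftrightarrow>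
     (\<forall>\<omega> \<in> space (stern_space pp). \<forall>t. int (queries (run pp (world_of \<omega>) A t)) \<le> q)"

definition finds_key_with_prob :: "params \<Rightarrow> program \<Rightarrow> real \<Rightarrow> bool" where
  "finds_key_with_prob pp A p \<longleftrightarrow>
     p \<le> measure (stern_space pp)
           {\<omega> \<in> space (stern_space pp).
              \<exists>t. answer (run pp (world_of \<omega>) A t) = Some (DVec (secret (world_of \<omega>)))}"

text \<open>
  \<open>finds_key_with_prob\<close> has no time bound of its own: an adversary that halts does not change its
  answer afterwards. A break is a recovery of the secret key. The constants are uniform over the class \<open>P\<close> of
  parameters, so the bounds hold along every family of parameters in \<open>P\<close>, however it depends on
  the security parameter.
\<close>

definition preserves_at_most_bits :: "(params \<Rightarrow> bool) \<Rightarrow> (params \<Rightarrow> real) \<Rightarrow> bool" where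
  "preserves_at_most_bits P b \<longleftrightarrow>
     (\<exists>A C p. 0 < p \<and>
        (\<forall>pp. P pp \<longrightarrow> halts_within pp A (C * 2 powr b pp) \<and> finds_key_with_prob pp A p))"

end

theory Submission
  imports Defs
begin

text \<open>
  The attack evaluates \<open>E0\<close> on about \<open>N/2\<close> guessed seeds, where \<open>N\<close> is about \<open>2^(l/2)\<close>, and tabulates
  the permutations under the resulting \<open>seed_y\<close>. In each of \<open>N\<close> signed rounds that has challenge \<open>1\<close> the
  signature shows \<open>seed_y\<close> and \<open>\<pi>(e)\<close>; if \<open>seed_y\<close> is in the table, the stored permutation yields \<open>e\<close>.
  By the birthday bound some round uses a guessed seed with constant probability, and that round
  has challenge \<open>1\<close> with probability \<open>1/3\<close>. Given the seeds of the rounds, a union bound over the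
  at most \<open>2^l/2\<close> pairs of a guess and a different round seed shows that with probability at least
  \<open>1/2\<close> no match is false. The challenge is independent of both events, since it is a random oracle
  value at a point that is determined without that oracle.
\<close>

section \<open>The attack and its runs\<close>

text \<open>The guesses are the fixed strings \<open>to_bits l 0\<close>,
  \<open>to_bits l 1\<close>, and so on, so the birthday argument needs no randomness of the
  adversary: at least \<open>N/2\<close> distinct fixed seeds face \<open>N\<close> independent
  uniform ones, which all miss them with probability at most \<open>exp (-1/4)\<close>. Together
  with \<open>1/2\<close> for false matches and \<open>1/3\<close> for the challenge this yields
  \<open>(1 - exp (-1/4)) / 6\<close>. The run stops at the first successful lookup, right or wrong.
  Hence false matches must be excluded at every round, not only at the one that is hit. All queries
  sign the empty message, so the digest in the signature is the whole argument of \<open>Hfs\<close>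
  and the attack can recompute the challenges. Digests of different queries may coincide; this is
  harmless, since only one round, selected by \<open>E0\<close> and the seeds, is followed through.
  The machine cannot divide: \<open>2^(l div 2)\<close> is obtained by doubling, and the number of
  guesses is halved by comparing \<open>i + i\<close> with the budget. Time and query bounds hold
  for every sample; only success is probabilistic.\<close>

text \<open>
  Registers 6 and 7 hold the input seed length and the number \<open>R\<close> of rounds, 8 holds \<open>1\<close>, 9 the budget.
  Register 10 is never written: its initial content \<open>DTup []\<close> serves as the number \<open>0\<close>, as the empty
  message and as the result of a failed lookup. The jump targets 3, 10 and 24 are the heads of the
  loops that compute the budget, tabulate the guesses and process the rounds; 26 requests a signature
  if the current one is used up, and 43 goes on to the next round.
\<close>

definition attack :: program where
  "attack =
    [Const 8 1, Const 9 1, Const 11 1,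
     Jump_Less 11 6 5,
     Jump_Eq 10 10 9,
     Add 9 9 9, Add 11 11 8, Add 11 11 8,
     Jump_Eq 10 10 3,
     Const 12 0,
     Add 13 12 12,
     Jump_Less 13 9 13,
     Jump_Eq 10 10 22,
     To_Bits 14 6 12, Eval_E0 14 14, Proj 15 14 10, Proj 16 14 8, Eval_E1 15 15,
     Perm_Inv 15 15, Store 16 15, Add 12 12 8,
     Jump_Eq 10 10 10,
     Const 17 0, Copy 21 7,
     Jump_Less 17 9 26,
     Halt 10,
     Jump_Less 21 7 33,
     Sign 18 10, Proj 19 18 10, Eval_Hfs 19 19, Const 20 2, Proj 20 18 20, Const 21 0,
     Proj 22 19 21,
     Jump_Eq 22 8 36,
     Jump_Eq 10 10 43,
     Proj 23 20 21, Proj 24 23 10, Lookup 24 24,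
     Jump_Eq 24 10 43,
     Proj 23 23 8, Permute 23 24 23, Halt 23,
     Add 21 21 8, Add 17 17 8,
     Jump_Eq 10 10 24]"

definition budget :: "params \<Rightarrow> nat" where
  "budget pp = 2 ^ (seed_length pp div 2)"

definition guess :: "params \<Rightarrow> nat \<Rightarrow> bitstring" where
  "guess pp i = to_bits (seed_length pp) i"

text \<open>
  Half the budget, so that the expected number of false matches is at most \<open>1/2\<close>.
\<close>

definition guess_count :: "params \<Rightarrow> nat" where
  "guess_count pp = (budget pp + 1) div 2"

definition guesses :: "params \<Rightarrow> bitstring set" where
  "guesses pp = guess pp ` {..<guess_count pp}"

definition round_index :: "params \<Rightarrow> nat \<Rightarrow> nat \<times> nat" where
  "round_index pp r = (r div rounds pp, r mod rounds pp)"

text \<open>The local \<open>x\<close> of \<open>signature\<close>, named because it is the point at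
  which \<open>Hfs\<close> is queried.\<close>

definition digest :: "world \<Rightarrow> bitstring list \<Rightarrow> bitstring" where
  "digest W sds =
     Hcomm W (DTup (concat (map (\<lambda>sd. map (\<lambda>i. DBits (commitment W sd i)) [1, 2, 3]) sds)))"

definition query_challenges :: "params \<Rightarrow> world \<Rightarrow> nat \<Rightarrow> nat list" where
  "query_challenges pp W q = Hfs W (digest W (map (\<lambda>j. fresh W (q, j)) [0..<rounds pp]))"

definition hit :: "params \<Rightarrow> world \<Rightarrow> nat \<Rightarrow> bool" where
  "hit pp W r \<longleftrightarrow> fresh W (round_index pp r) \<in> guesses pp \<and>
     query_challenges pp W (r div rounds pp) ! (r mod rounds pp) = 1"

text \<open>
  A revealed \<open>seed_y\<close> may also match a guess other than the seed that it comes from. The attack cannot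
  rule this out by a test: nothing forces the commitments or the syndrome to be nonempty.
\<close>

definition no_false_match ::
    "params \<Rightarrow> (bitstring \<Rightarrow> bitstring \<times> bitstring) \<Rightarrow> (nat \<times> nat \<Rightarrow> bitstring) \<Rightarrow> bool" where
  "no_false_match pp e0 \<rho> \<longleftrightarrow>
     (\<forall>s\<in>guesses pp. \<forall>r<budget pp.
        snd (e0 s) = snd (e0 (\<rho> (round_index pp r))) \<longrightarrow> s = \<rho> (round_index pp r))"

abbreviation conf :: "nat \<Rightarrow> (reg \<Rightarrow> data) \<Rightarrow> (data \<Rightarrow> data option) \<Rightarrow> nat \<Rightarrow> config" where
  "conf p m tb q \<equiv> \<lparr>pc = p, mem = m, table = tb, queries = q, answer = None\<rparr>"

lemma act_act_inv:
  assumes "\<pi> permutes {..<n}" "v \<in> carrier_vec n"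
  shows "act (Hilbert_Choice.inv \<pi>) (act \<pi> v) = v"
proof (intro eq_vecI)
  fix i assume "i < dim_vec v"
  then have "i < n" using assms by auto
  then have "\<pi> i < n" using permutes_in_image[OF assms(1), of i] by auto
  then show "act (Hilbert_Choice.inv \<pi>) (act \<pi> v) $ i = v $ i"
    using \<open>i < n\<close> assms
    by (auto simp: act_def permutes_inv_inv permutes_inverses)
qed (auto simp: act_def)

text \<open>Range conditions that hold for every sample, so that halting and the query bound hold
  surely.\<close>

locale attacked_world =
  fixes pp :: params and W :: world
  assumes valid: "valid_params pp"
    and E0_seeds: "\<And>sd. sd \<in> bitstrings (seed_length pp) \<Longrightarrow>
        E0 W sd \<in> bitstrings (seed_length pp) \<times> bitstrings (seed_length pp)"
    and E1_perm: "\<And>sd. sd \<in> bitstrings (seed_length pp) \<Longrightarrow> E1 W sd \<in> Perm (code_length pp)"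
    and challenges: "\<And>b. Hfs W b \<in> challenges (rounds pp)"
    and secret_dim: "secret W \<in> carrier_vec (code_length pp)"
    and fresh_seed: "\<And>ij. fresh W ij \<in> bitstrings (seed_length pp)"
begin

section \<open>Symbolic execution of the program with step counts\<close>

definition tick :: "config \<Rightarrow> config" where
  "tick = step pp W attack"

text \<open>At most \<open>k\<close> steps instead of exactly \<open>k\<close>, so that branches of
  different length share one bound.\<close>

definition reach :: "nat \<Rightarrow> config \<Rightarrow> config \<Rightarrow> bool" where
  "reach k c c' \<longleftrightarrow> (\<exists>t\<le>k. (tick ^^ t) c = c')"

lemma reach_refl: "reach k c c"
  by (auto simp: reach_def intro!: exI[of _ 0])

lemma reach_trans:
  assumes "reach k c c'" "reach k' c' c''" "k + k' \<le> k''"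
  shows "reach k'' c c''"
proof -
  obtain t t' where "t \<le> k" "(tick ^^ t) c = c'"
    "t' \<le> k'" "(tick ^^ t') c' = c''"
    using assms unfolding reach_def by auto
  then have "(tick ^^ (t' + t)) c = c''" "t' + t \<le> k''"
    using assms(3) by (auto simp: funpow_add)
  then show ?thesis unfolding reach_def by blast
qed

lemma reach_stepI: "reach k (tick c) c' \<Longrightarrow> reach (Suc k) c c'"
  unfolding reach_def by (metis Suc_le_mono comp_apply funpow_Suc_right)

text \<open>Peels one step off a numeral bound; with it one \<open>simp\<close> call executes one
  instruction of straight-line code.\<close>

lemma reach_numeral:
  "reach (pred_numeral k) (tick c) c' \<Longrightarrow> reach (numeral k) c c'"
  using reach_stepI[of "pred_numeral k"] by (simp add: numeral_eq_Suc)

text \<open>\<open>46\<close> is the number of instructions of \<open>attack\<close>, so the machine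
  is not stuck at \<open>p\<close>.\<close>

lemma tick_conf:
  "p < 46 \<Longrightarrow> tick (conf p m tb q) = exec pp W (attack ! p) (conf p m tb q)"
  by (simp add: tick_def step_def attack_def)

lemmas machine = tick_conf attack_def assign_def jump_def as_nat_def as_bits_def as_vec_def
  as_perm_def as_tup_def proj_def

text \<open>Register 9 holds \<open>2 ^ k\<close> and register 11 holds \<open>2 * k + 1\<close>:
  the condition \<open>k < l div 2\<close> is tested as \<open>2 * k + 1 < l\<close>, which is
  equivalent for both parities of the seed length \<open>l\<close>.\<close>

lemma doubling_loop:
  assumes "m 6 = DNat (seed_length pp)" "m 8 = DNat 1" "m 10 = DTup []"
    "m 9 = DNat (2 ^ k)" "m 11 = DNat (2 * k + 1)" "k \<le> seed_length pp div 2"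
  shows "\<exists>m'. reach (6 * (seed_length pp div 2 - k) + 2) (conf 3 m tb q) (conf 9 m' tb q) \<and>
    m' 9 = DNat (budget pp) \<and> (\<forall>r. r \<noteq> 9 \<longrightarrow> r \<noteq> 11 \<longrightarrow> m' r = m r)"
  using assms
proof (induction "seed_length pp div 2 - k" arbitrary: k m)
  case 0
  then have "k = seed_length pp div 2" by simp
  moreover from this have "\<not> 2 * k + 1 < seed_length pp" by linarith
  ultimately have "reach 2 (conf 3 m tb q) (conf 9 m tb q)"
    apply -
    apply (rule reach_numeral, simp add: machine 0(2-7))
    apply (rule reach_stepI, simp add: machine 0(2-7) reach_refl)
    done
  then show ?case using 0(2-7) \<open>k = _\<close> by (intro exI[of _ m]) (auto simp: budget_def numeral_2_eq_2)
next
  case (Suc d)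
  then have "k < seed_length pp div 2" by simp
  have d: "d = seed_length pp div 2 - Suc k" using Suc.hyps(2) by linarith
  from \<open>k < _\<close> have lt: "Suc (2 * k) < seed_length pp" by linarith
  define m1 where "m1 = m(9 := DNat (2 ^ Suc k), 11 := DNat (2 * Suc k + 1))"
  have 1: "reach 5 (conf 3 m tb q) (conf 3 m1 tb q)"
    apply (rule reach_numeral, simp add: machine Suc.prems lt)
    apply (rule reach_numeral, simp add: machine Suc.prems)
    apply (rule reach_numeral, simp add: machine Suc.prems)
    apply (rule reach_numeral, simp add: machine Suc.prems)
    apply (rule reach_stepI, simp add: machine Suc.prems)
    apply (simp add: m1_def fun_upd_twist mult_2 reach_refl)
    done
  obtain m' where 2: "reach (6 * (seed_length pp div 2 - Suc k) + 2) (conf 3 m1 tb q) (conf 9 m' tb q)"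
    and m': "m' 9 = DNat (budget pp)" "\<forall>r. r \<noteq> 9 \<longrightarrow> r \<noteq> 11 \<longrightarrow> m' r = m1 r"
    using Suc.hyps(1)[of "Suc k" m1, OF d] Suc.prems \<open>k < _\<close> by (auto simp: m1_def)
  show ?case
    using reach_trans[OF 1 2, of "6 * (seed_length pp div 2 - k) + 2"] \<open>k < _\<close> m'
    by (intro exI[of _ m']) (auto simp: m1_def)
qed


text \<open>Guesses with the same \<open>seed_y\<close> overwrite each other, so an entry is only
  known to come from some guess with that key.\<close>

definition table_upto :: "nat \<Rightarrow> (data \<Rightarrow> data option) \<Rightarrow> bool" where
  "table_upto n tb \<longleftrightarrow>
     (\<forall>k d. tb k = Some d \<longrightarrow> (\<exists>i<n. k = DBits (snd (E0 W (guess pp i))) \<and>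
        d = DPerm (Hilbert_Choice.inv (E1 W (fst (E0 W (guess pp i))))))) \<and>
     (\<forall>i<n. tb (DBits (snd (E0 W (guess pp i)))) \<noteq> None)"

lemma table_upto_Suc:
  assumes "table_upto i tb"
  shows "table_upto (Suc i) (tb(DBits (snd (E0 W (guess pp i))) \<mapsto>
    DPerm (Hilbert_Choice.inv (E1 W (fst (E0 W (guess pp i)))))))"
  using assms unfolding table_upto_def by (auto simp: less_Suc_eq)

text \<open>The test \<open>i + i < budget pp\<close> amounts to \<open>i < guess_count pp\<close>,
  the latter being half the budget rounded up. One pass takes 11 steps.\<close>

lemma guessing_loop:
  assumes "m 6 = DNat (seed_length pp)" "m 8 = DNat 1" "m 10 = DTup []"
    "m 9 = DNat (budget pp)" "m 12 = DNat i" "i \<le> guess_count pp" "table_upto i tb"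
  shows "\<exists>m' tb'. reach (11 * (guess_count pp - i) + 3) (conf 10 m tb q) (conf 22 m' tb' q) \<and>
    table_upto (guess_count pp) tb' \<and> (\<forall>r<12. m' r = m r)"
  using assms
proof (induction "guess_count pp - i" arbitrary: i m tb)
  case 0
  then have "i = guess_count pp" by simp
  moreover from this have ge: "\<not> i + i < budget pp" unfolding guess_count_def by linarith
  ultimately have "reach 3 (conf 10 m tb q) (conf 22 (m(13 := DNat (i + i))) tb q)"
    apply -
    apply (rule reach_numeral, simp add: machine 0(2-7))
    apply (rule reach_numeral, simp add: machine 0(2-7))
    apply (rule reach_stepI, simp add: machine 0(2-7) reach_refl)
    done
  moreover have "\<forall>r<12. (m(13 := DNat (i + i))) r = m r" by simp
  moreover have "table_upto (guess_count pp) tb" using 0 \<open>i = _\<close> by simp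
  ultimately show ?case using \<open>i = _\<close> by (metis diff_self_eq_0 mult_0_right add_0)
next
  case (Suc d)
  then have "i < guess_count pp" and d: "d = guess_count pp - Suc i" by auto
  then have lt: "i + i < budget pp" unfolding guess_count_def by linarith
  let ?sd = "to_bits (seed_length pp) i"
  define tb1 where "tb1 = tb(DBits (snd (E0 W (guess pp i))) \<mapsto>
    DPerm (Hilbert_Choice.inv (E1 W (fst (E0 W (guess pp i))))))"
  have "\<exists>m1. reach 11 (conf 10 m tb q) (conf 10 m1 tb1 q) \<and>
    m1 12 = DNat (Suc i) \<and> (\<forall>r<12. m1 r = m r)"
    apply (rule exI, rule conjI)
     apply (rule reach_numeral, simp add: machine Suc.prems)
     apply (rule reach_numeral, simp add: machine Suc.prems lt)
     apply (rule reach_numeral, simp add: machine Suc.prems)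
     apply (rule reach_numeral, simp add: machine Suc.prems)
     apply (rule reach_numeral, simp add: machine Suc.prems split_beta)
     apply (rule reach_numeral, simp add: machine Suc.prems)
     apply (rule reach_numeral, simp add: machine Suc.prems)
     apply (rule reach_numeral, simp add: machine Suc.prems)
     apply (rule reach_numeral, simp add: machine Suc.prems)
     apply (rule reach_numeral, simp add: machine Suc.prems)
     apply (rule reach_stepI, simp add: machine Suc.prems)
     apply (fold guess_def)
     apply (fold tb1_def)
     apply (rule reach_refl)
    apply simp
    done
  then obtain m1 where 1: "reach 11 (conf 10 m tb q) (conf 10 m1 tb1 q)"
    and m1: "m1 12 = DNat (Suc i)" "\<forall>r<12. m1 r = m r" by blast
  obtain m' tb' where 2: "reach (11 * (guess_count pp - Suc i) + 3) (conf 10 m1 tb1 q) (conf 22 m' tb' q)"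
    and m': "table_upto (guess_count pp) tb'" "\<forall>r<12. m' r = m1 r"
    using Suc.hyps(1)[of "Suc i" m1 tb1, OF d] Suc.prems \<open>i < _\<close> m1
      table_upto_Suc[OF Suc.prems(7)] by (auto simp: tb1_def)
  show ?case
    using reach_trans[OF 1 2, of "11 * (guess_count pp - i) + 3"] \<open>i < _\<close> m1 m' by fastforce
qed

definition responses :: "nat \<Rightarrow> data list" where
  "responses q = map2 (response W) (map (\<lambda>j. fresh W (q, j)) [0..<rounds pp])
     (query_challenges pp W q)"

lemma length_query_challenges: "length (query_challenges pp W q) = rounds pp"
  using challenges unfolding query_challenges_def challenges_def by blast

lemma length_responses: "length (responses q) = rounds pp"
  by (simp add: responses_def length_query_challenges)

lemma nth_responses:
  "j < rounds pp \<Longrightarrow> responses q ! j = response W (fresh W (q, j)) (query_challenges pp W q ! j)"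
  by (simp add: responses_def length_query_challenges)

text \<open>The revealed commitments stay an anonymous \<open>xs\<close>, since the attack never
  reads them.\<close>

lemma signature_eq:
  fixes q
  defines "sds \<equiv> map (\<lambda>j. fresh W (q, j)) [0..<rounds pp]"
  obtains xs where "signature W sds [] = DTup [DBits (digest W sds), xs, DTup (responses q)]"
  unfolding signature_def Let_def digest_def[symmetric] responses_def query_challenges_def sds_def
  by auto

text \<open>
  Here \<open>r\<close> rounds have been processed, \<open>j\<close> of them from the latest signature; \<open>j = R\<close> means that
  this signature is used up, which is also how the loop is entered with no signature at all.
\<close>

definition round_state :: "nat \<Rightarrow> nat \<Rightarrow> nat \<Rightarrow> (reg \<Rightarrow> data) \<Rightarrow> bool" where
  "round_state r j q m \<longleftrightarrow>
     m 7 = DNat (rounds pp) \<and> m 8 = DNat 1 \<and> m 9 = DNat (budget pp) \<and> m 10 = DTup [] \<and>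
     m 17 = DNat r \<and> m 21 = DNat j \<and>
     j \<le> rounds pp \<and> r \<le> budget pp \<and> r + rounds pp = q * rounds pp + j \<and>
     q * rounds pp < budget pp + rounds pp \<and>
     (j < rounds pp \<longrightarrow> m 19 = DTup (map DNat (query_challenges pp W (q - 1))) \<and>
        m 20 = DTup (responses (q - 1)))"

text \<open>The program signs only when the last signature is used up, so \<open>r = q * R\<close>
  with \<open>r < N\<close>; hence \<open>(q + 1) * R < N + R\<close> after the query, which is the
  query bound in \<open>round_state\<close>.\<close>

lemma signing_phase:
  assumes st: "round_state r j q m" and "r < budget pp"
  shows "\<exists>m' j' q'. reach 7 (conf 26 m tb q) (conf 33 m' tb q') \<and> round_state r j' q' m' \<and> j' < rounds pp"
proof (cases "j < rounds pp")
  case True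
  have "reach 1 (conf 26 m tb q) (conf 33 m tb q)"
    unfolding One_nat_def
    apply (rule reach_stepI)
    using st True by (simp add: machine round_state_def reach_refl)
  then show ?thesis using st True reach_trans[OF _ reach_refl, of 1 _ _ 6 7] by fastforce
next
  case False
  with st have j: "j = rounds pp" by (simp add: round_state_def)
  with st have r: "r = q * rounds pp" by (simp add: round_state_def)
  obtain xs where sig: "signature W (map (\<lambda>j. fresh W (q, j)) [0..<rounds pp]) [] =
      DTup [DBits (digest W (map (\<lambda>j. fresh W (q, j)) [0..<rounds pp])), xs, DTup (responses q)]"
    by (rule signature_eq)
  note st' = st[unfolded round_state_def]
  have "\<exists>m'. reach 7 (conf 26 m tb q) (conf 33 m' tb (Suc q)) \<and> round_state r 0 (Suc q) m'"
    apply (rule exI, rule conjI)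
     apply (rule reach_numeral, simp add: machine st' j)
     apply (rule reach_numeral, simp add: machine st' sig)
     apply (rule reach_numeral, simp add: machine st')
     apply (rule reach_numeral, simp add: machine st')
     apply (rule reach_numeral, simp add: machine st')
     apply (rule reach_numeral, simp add: machine st')
     apply (rule reach_stepI, simp add: machine st')
     apply (rule reach_refl)
    using st' assms(2) r valid
    apply (simp add: round_state_def query_challenges_def valid_params_def)
    done
  then show ?thesis using valid unfolding valid_params_def by fastforce
qed


text \<open>Any entry found comes from a guess with the same \<open>seed_y\<close>; without false
  matches that guess is the seed of the round, so the stored permutation inverts the one applied to
  the secret.\<close>

lemma round_hit_answer:
  assumes "table_upto (guess_count pp) tb" "r < budget pp"
    "no_false_match pp (E0 W) (fresh W)"
    "tb (DBits (snd (E0 W (fresh W (round_index pp r))))) = Some d"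
  shows "act (as_perm d) (act (seed_perm W (fresh W (round_index pp r))) (secret W)) = secret W"
proof -
  let ?f = "fresh W (round_index pp r)"
  obtain i where i: "i < guess_count pp" "snd (E0 W ?f) = snd (E0 W (guess pp i))"
    and d: "d = DPerm (Hilbert_Choice.inv (E1 W (fst (E0 W (guess pp i)))))"
    using assms(1,4) unfolding table_upto_def by fastforce
  have "guess pp i = ?f"
    using assms(2,3) i unfolding no_false_match_def guesses_def by auto
  then have "d = DPerm (Hilbert_Choice.inv (seed_perm W ?f))"
    using d by (simp add: seed_perm_def)
  moreover have "seed_perm W ?f permutes {..<code_length pp}"
    using E1_perm E0_seeds fresh_seed unfolding seed_perm_def Perm_def
    by (metis mem_Collect_eq mem_Times_iff)
  ultimately show ?thesis
    using act_act_inv secret_dim by (simp add: as_perm_def)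
qed

text \<open>Only hits from round \<open>r\<close> on are promised: passing over a round that is no
  hit loses nothing, so the property is carried backwards along the loop. The query bound is kept as
  a product to avoid dividing by \<open>R\<close>.\<close>

definition finished :: "nat \<Rightarrow> config \<Rightarrow> bool" where
  "finished r c \<longleftrightarrow> answer c \<noteq> None \<and> queries c * rounds pp < budget pp + rounds pp \<and>
     (no_false_match pp (E0 W) (fresh W) \<and> (\<exists>r'\<ge>r. r' < budget pp \<and> hit pp W r') \<longrightarrow>
        answer c = Some (DVec (secret W)))"

text \<open>A round is passed over if its challenge is not 1 or its \<open>seed_y\<close> is missing
  from the table; either rules out a hit, as the table has an entry for every guess. A successful
  lookup ends the run, and the answer is correct if there are no false matches.\<close>

lemma processing_phase:
  assumes st: "round_state r j q m" "r < budget pp" "j < rounds pp"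
    and tb: "table_upto (guess_count pp) tb"
  shows "(\<exists>c. reach 10 (conf 33 m tb q) c \<and> finished r c) \<or>
    (\<exists>m'. reach 10 (conf 33 m tb q) (conf 24 m' tb q) \<and> round_state (Suc r) (Suc j) q m' \<and>
      \<not> hit pp W r)"
proof -
  note st' = st[unfolded round_state_def]
  \<comment> \<open>With \<open>q = 0\<close> the invariant would read \<open>r + R = j\<close>,
    contradicting \<open>j < R\<close>.\<close>
  have "q \<noteq> 0" using st' by (auto intro: ccontr)
  then obtain q' where q: "q = Suc q'" by (cases q) auto
  then have "r = j + q' * rounds pp" using st' by simp
  then have ix: "r div rounds pp = q'" "r mod rounds pp = j" "round_index pp r = (q', j)"
    using st(3) by (auto simp: round_index_def)
  let ?f = "fresh W (q', j)"
  let ?key = "DBits (snd (E0 W ?f))"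
  have skip: "\<exists>m''. reach 3 (conf 43 m' tb q) (conf 24 m'' tb q) \<and> round_state (Suc r) (Suc j) q m''"
    if m': "\<forall>r<22. m' r = m r" for m'
    apply (rule exI, rule conjI)
     apply (rule reach_numeral, simp add: machine st' m')
     apply (rule reach_numeral, simp add: machine st' m')
     apply (rule reach_stepI, simp add: machine st' m')
     apply (rule reach_refl)
    using st' m' by (simp add: round_state_def)
  show ?thesis
  proof (cases "query_challenges pp W q' ! j = 1")
    case False
    then have "\<not> hit pp W r" by (simp add: hit_def ix)
    have "\<exists>m'. reach 3 (conf 33 m tb q) (conf 43 m' tb q) \<and> (\<forall>r<22. m' r = m r)"
      apply (rule exI, rule conjI)
       apply (rule reach_numeral, simp add: machine st' q length_query_challenges)
       apply (rule reach_numeral, simp add: machine st' False[simplified])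
       apply (rule reach_stepI, simp add: machine st')
       apply (rule reach_refl)
      by simp
    then obtain m' where 1: "reach 3 (conf 33 m tb q) (conf 43 m' tb q)" "\<forall>r<22. m' r = m r"
      by blast
    with skip obtain m'' where 2: "reach 3 (conf 43 m' tb q) (conf 24 m'' tb q)"
      "round_state (Suc r) (Suc j) q m''" by blast
    then show ?thesis using reach_trans[OF 1(1) 2(1), of 10] \<open>\<not> hit pp W r\<close> by auto
  next
    case chal: True
    have resp: "responses q' ! j = DTup [?key, DVec (act (seed_perm W ?f) (secret W))]"
      using st chal by (simp add: nth_responses response_def)
    show ?thesis
    proof (cases "tb ?key")
      case None
      then have "?f \<notin> guesses pp"
        using tb unfolding table_upto_def guesses_def by (metis imageE lessThan_iff)
      then have "\<not> hit pp W r" by (simp add: hit_def ix)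
      have "\<exists>m'. reach 6 (conf 33 m tb q) (conf 43 m' tb q) \<and> (\<forall>r<22. m' r = m r)"
        apply (rule exI, rule conjI)
         apply (rule reach_numeral, simp add: machine st' q length_query_challenges)
         apply (rule reach_numeral, simp add: machine st' chal[simplified])
         apply (rule reach_numeral, simp add: machine st' q length_responses resp)
         apply (rule reach_numeral, simp add: machine st')
         apply (rule reach_numeral, simp add: machine st' None)
         apply (rule reach_stepI, simp add: machine st')
         apply (rule reach_refl)
        by simp
      then obtain m' where 1: "reach 6 (conf 33 m tb q) (conf 43 m' tb q)" "\<forall>r<22. m' r = m r"
        by blast
      with skip obtain m'' where 2: "reach 3 (conf 43 m' tb q) (conf 24 m'' tb q)"
        "round_state (Suc r) (Suc j) q m''" by blast
      then show ?thesis using reach_trans[OF 1(1) 2(1), of 10] \<open>\<not> hit pp W r\<close> by auto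
    next
      case (Some d)
      \<comment> \<open>A stored value is a \<open>DPerm\<close>, so it cannot be confused with the
        \<open>DTup []\<close> of a failed lookup.\<close>
      then have d: "d \<noteq> DTup []"
        using tb unfolding table_upto_def by fastforce
      have "\<exists>m'. reach 9 (conf 33 m tb q) \<lparr>pc = 42, mem = m', table = tb, queries = q,
          answer = Some (DVec (act (as_perm d) (act (seed_perm W ?f) (secret W))))\<rparr>"
        apply (rule exI)
        apply (rule reach_numeral, simp add: machine st' q length_query_challenges)
        apply (rule reach_numeral, simp add: machine st' chal[simplified])
        apply (rule reach_numeral, simp add: machine st' q length_responses resp)
        apply (rule reach_numeral, simp add: machine st')
        apply (rule reach_numeral, simp add: machine st' Some)
        apply (rule reach_numeral, simp add: machine st' d)
        apply (rule reach_numeral, simp add: machine st')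
        apply (rule reach_numeral, simp add: machine st')
        apply (rule reach_stepI, simp add: machine st')
        apply (rule reach_refl)
        done
      then obtain c where 1: "reach 9 (conf 33 m tb q) c" and c: "queries c = q"
        "answer c = Some (DVec (act (as_perm d) (act (seed_perm W ?f) (secret W))))"
        by fastforce
      have "finished r c"
        unfolding finished_def using c st' round_hit_answer[OF tb st(2), of d] Some
        by (auto simp: ix)
      then show ?thesis using reach_trans[OF 1 reach_refl, of 0 10] by auto
    qed
  qed
qed

text \<open>A pass costs at most \<open>18 = 1 + 7 + 10\<close> steps: the loop test, a possible
  signature, one round. Once all rounds are used up, no hit is left to be promised and the answer is
  arbitrary.\<close>

lemma online_loop:
  assumes "round_state r j q m" "table_upto (guess_count pp) tb"
  shows "\<exists>c. reach (18 * (budget pp - r) + 2) (conf 24 m tb q) c \<and> finished r c"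
  using assms
proof (induction "budget pp - r" arbitrary: r j q m)
  case 0
  note st = 0(2)[unfolded round_state_def]
  have "r = budget pp" using 0 st by simp
  then have "reach 2 (conf 24 m tb q)
    \<lparr>pc = 25, mem = m, table = tb, queries = q, answer = Some (DTup [])\<rparr>"
    apply -
    apply (rule reach_numeral, simp add: machine st)
    apply (rule reach_stepI, simp add: machine st reach_refl)
    done
  then show ?case using st \<open>r = _\<close>
    by (fastforce simp: finished_def numeral_2_eq_2)
next
  case (Suc n)
  then have lt: "r < budget pp" and n: "n = budget pp - Suc r" by auto
  note st = Suc.prems(1)[unfolded round_state_def]
  have 1: "reach 1 (conf 24 m tb q) (conf 26 m tb q)"
    unfolding One_nat_def
    by (rule reach_stepI) (simp add: machine st lt reach_refl)
  obtain m1 j1 q1 where 2: "reach 7 (conf 26 m tb q) (conf 33 m1 tb q1)"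
    and st1: "round_state r j1 q1 m1" "j1 < rounds pp"
    using signing_phase[OF Suc.prems(1) lt] by blast
  have 3: "reach 8 (conf 24 m tb q) (conf 33 m1 tb q1)"
    using reach_trans[OF 1 2] by simp
  consider c where "reach 10 (conf 33 m1 tb q1) c" "finished r c"
    | m' where "reach 10 (conf 33 m1 tb q1) (conf 24 m' tb q1)"
        "round_state (Suc r) (Suc j1) q1 m'" "\<not> hit pp W r"
    using processing_phase[OF st1(1) lt st1(2) Suc.prems(2)] by blast
  then show ?case
  proof cases
    case 1
    moreover have "8 + 10 \<le> 18 * (budget pp - r) + 2" using lt by linarith
    ultimately show ?thesis using reach_trans[OF 3 1(1)] by blast
  next
    case 2
    obtain c where c: "reach (18 * (budget pp - Suc r) + 2) (conf 24 m' tb q1) c" "finished (Suc r) c"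
      using Suc.hyps(1)[OF n 2(2) Suc.prems(2)] by blast
    have "reach (18 * (budget pp - r) + 2) (conf 24 m tb q) c"
      using reach_trans[OF reach_trans[OF 3 2(1) order.refl] c(1)] lt by simp
    moreover have "finished r c"
      using c(2) 2(3) unfolding finished_def by (metis le_neq_implies_less Suc_leI)
    ultimately show ?thesis by blast
  qed
qed

text \<open>Keeps the cost of computing the budget, which is linear in the seed length, within a
  constant times the budget.\<close>

lemma seed_length_le_budget: "seed_length pp div 2 \<le> budget pp"
  unfolding budget_def using less_exp[of "seed_length pp div 2"] by simp

lemma attack_run:
  "\<exists>t \<le> 60 * budget pp. finished 0 (run pp W attack t)"
proof -
  have b: "1 \<le> budget pp" by (simp add: budget_def)
  define m0 where "m0 = proj (inputs pp (parity W) (syndrome W))"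
  have start: "start pp W = conf 0 m0 Map.empty 0" by (simp add: start_def m0_def)
  have m0: "m0 6 = DNat (seed_length pp)" "m0 7 = DNat (rounds pp)" "m0 10 = DTup []"
    by (simp_all add: m0_def inputs_def proj_def)
  have "\<exists>m1. reach 3 (conf 0 m0 Map.empty 0) (conf 3 m1 Map.empty 0) \<and> m1 8 = DNat 1 \<and>
      m1 9 = DNat 1 \<and> m1 11 = DNat 1 \<and> m1 6 = m0 6 \<and> m1 7 = m0 7 \<and> m1 10 = m0 10"
    apply (rule exI, rule conjI)
     apply (rule reach_numeral, simp add: machine)
     apply (rule reach_numeral, simp add: machine)
     apply (rule reach_stepI, simp add: machine numeral_3_eq_3)
     apply (rule reach_refl)
    by simp
  then obtain m1 where 1: "reach 3 (conf 0 m0 Map.empty 0) (conf 3 m1 Map.empty 0)"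
    and m1: "m1 8 = DNat 1" "m1 9 = DNat 1" "m1 11 = DNat 1" "m1 6 = m0 6" "m1 7 = m0 7"
      "m1 10 = m0 10" by blast
  obtain m2 where 2: "reach (6 * (seed_length pp div 2) + 2) (conf 3 m1 Map.empty 0)
      (conf 9 m2 Map.empty 0)"
    and m2: "m2 9 = DNat (budget pp)" "\<forall>r. r \<noteq> 9 \<longrightarrow> r \<noteq> 11 \<longrightarrow> m2 r = m1 r"
    using doubling_loop[of m1 0 Map.empty 0] m0 m1 by auto
  define m3 where "m3 = m2(12 := DNat 0)"
  have 3: "reach 1 (conf 9 m2 Map.empty 0) (conf 10 m3 Map.empty 0)"
    unfolding One_nat_def by (rule reach_stepI) (simp add: machine m3_def reach_refl)
  obtain m4 tb where 4: "reach (11 * guess_count pp + 3) (conf 10 m3 Map.empty 0) (conf 22 m4 tb 0)"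
    and tb: "table_upto (guess_count pp) tb" and m4: "\<forall>r<12. m4 r = m3 r"
    using guessing_loop[of m3 0 Map.empty 0] m0 m1 m2 by (auto simp: m3_def table_upto_def)
  have "\<exists>m5. reach 2 (conf 22 m4 tb 0) (conf 24 m5 tb 0) \<and> round_state 0 (rounds pp) 0 m5"
    apply (rule exI, rule conjI)
     apply (rule reach_numeral, simp add: machine)
     apply (rule reach_stepI, simp add: machine)
     apply (rule reach_refl)
    using m0 m1 m2 m4 b by (simp add: round_state_def m3_def)
  then obtain m5 where 5: "reach 2 (conf 22 m4 tb 0) (conf 24 m5 tb 0)"
    and m5: "round_state 0 (rounds pp) 0 m5" by blast
  obtain c where 6: "reach (18 * budget pp + 2) (conf 24 m5 tb 0) c" and c: "finished 0 c"
    using online_loop[OF m5 tb] by auto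
  \<comment> \<open>As \<open>l div 2\<close>, \<open>guess_count pp\<close> and 1 are at most the
    budget \<open>N\<close>, the phases sum to at most \<open>(6 + 11 + 18) * N + 13\<close>, which
    is below \<open>60 * N\<close>.\<close>
  have "guess_count pp \<le> budget pp" using b by (simp add: guess_count_def)
  then have "reach (60 * budget pp) (conf 0 m0 Map.empty 0) c"
    using seed_length_le_budget b
    by (intro reach_trans[OF 1 reach_trans[OF 2 reach_trans[OF 3 reach_trans[OF 4
            reach_trans[OF 5 6 order.refl] order.refl] order.refl] order.refl]]) simp
  then show ?thesis
    using c unfolding reach_def run_def start tick_def by blast
qed

end

section \<open>Measurability\<close>

lemma simple_function_measurable_compose:
  assumes "simple_function M f" "g \<in> measurable N M"
  shows "simple_function N (\<lambda>x. f (g x))"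
proof -
  have "(\<lambda>x. f (g x)) ` space N \<subseteq> f ` space M"
    using measurable_space[OF assms(2)] by auto
  then show ?thesis
    using assms measurable_compose[OF assms(2)] unfolding simple_function_eq_measurable
    by (auto intro: finite_subset)
qed

lemma simple_function_apply:
  "simple_function M f \<Longrightarrow> simple_function M (\<lambda>x. g (f x))"
  using simple_function_compose[of M f g] by (simp add: comp_def)

text \<open>Covers an oracle evaluated at a random point: \<open>f\<close> has finitely many values,
  so a preimage splits into finitely many pieces on each of which the point is fixed.\<close>

lemma simple_function_bind:
  assumes f: "simple_function M f" and g: "\<And>y. simple_function M (\<lambda>x. g y x)"
  shows "simple_function M (\<lambda>x. g (f x) x)"
  unfolding simple_function_def
proof (intro conjI ballI)
  have "(\<lambda>x. g (f x) x) ` space M \<subseteq> (\<Union>y\<in>f ` space M. g y ` space M)" by auto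
  then show "finite ((\<lambda>x. g (f x) x) ` space M)"
    by (rule finite_subset)
      (intro finite_UN_I simple_functionD(1)[OF f] simple_functionD(1)[OF g])
next
  fix z
  have "(\<lambda>x. g (f x) x) -` {z} \<inter> space M =
      (\<Union>y\<in>f ` space M. (f -` {y} \<inter> space M) \<inter> (g y -` {z} \<inter> space M))" by auto
  also have "\<dots> \<in> sets M"
    using simple_functionD[OF f] simple_functionD[OF g] by (intro sets.finite_UN) auto
  finally show "(\<lambda>x. g (f x) x) -` {z} \<inter> space M \<in> sets M" .
qed

lemma simple_function_map:
  assumes "\<And>a. simple_function M (\<lambda>x. f a x)"
  shows "simple_function M (\<lambda>x. map (\<lambda>a. f a x) as)"
proof (induction as)
  case (Cons a as)
  show ?case
    using simple_function_apply[OF simple_function_Pair[OF assms[of a] Cons], of "\<lambda>(u, v). u # v"]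
    by simp
qed simp

lemma simple_function_apply2:
  "simple_function M f \<Longrightarrow> simple_function M g \<Longrightarrow> simple_function M (\<lambda>x. h (f x) (g x))"
  using simple_function_apply[of M "\<lambda>x. (f x, g x)" "\<lambda>(u, v). h u v"] by simp

lemma simple_function_ex_less:
  assumes "\<And>i. simple_function M (\<lambda>x. P i x)"
  shows "simple_function M (\<lambda>x. \<exists>i<n::nat. P i x)"
proof (induction n)
  case (Suc n)
  have "simple_function M (\<lambda>x. (\<exists>i<n. P i x) \<or> P n x)"
    by (rule simple_function_apply2[OF Suc assms])
  then show ?case by (simp add: less_Suc_eq ex_disj_distrib conj_disj_distribR)
qed simp

lemma simple_function_Collect:
  "simple_function M P \<Longrightarrow> {x \<in> space M. P x} \<in> sets M"
  using simple_functionD(2)[of M P "{True}"] by (simp add: vimage_def Int_def conj_commute)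

lemma simple_function_uniform:
  "finite B \<Longrightarrow> simple_function (uniform_count_measure B) f"
  by (auto simp: simple_function_def space_uniform_count_measure sets_uniform_count_measure)

lemma space_random_function: "space (random_function A B) = A \<rightarrow>\<^sub>E B"
  by (simp add: random_function_def space_PiM space_uniform_count_measure)

lemma simple_function_random_function:
  assumes "finite B"
  shows "simple_function (random_function A B) (\<lambda>f. f a)"
proof (cases "a \<in> A")
  case True
  have "simple_function (uniform_count_measure B) (\<lambda>b. b)"
    using assms by (rule simple_function_uniform)
  moreover have "(\<lambda>f. f a) \<in> measurable (random_function A B) (uniform_count_measure B)"
    unfolding random_function_def using True by measurable
  ultimately show ?thesis by (rule simple_function_measurable_compose)
next
  case False
  \<comment> \<open>A program may evaluate an oracle at any string; outside \<open>A\<close> the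
    value is the same for all samples.\<close>
  then have "f a = undefined" if "f \<in> space (random_function A B)" for f
    using that by (auto simp: space_random_function)
  then show ?thesis by (subst simple_function_cong[where g = "\<lambda>_. undefined"]) auto
qed

lemma prob_space_random_function:
  "finite B \<Longrightarrow> B \<noteq> {} \<Longrightarrow> prob_space (random_function A B)"
  unfolding random_function_def by (intro prob_space_PiM prob_space_uniform_count_measure)

section \<open>The sets sampled from are finite and nonempty\<close>

lemma finite_carrier_vec_bit: "finite (carrier_vec n :: bit Matrix.vec set)"
proof -
  have "(UNIV :: bit set) = {0, 1}" using bit.exhaust by auto
  then have "finite (UNIV :: bit set)" by (metis finite.emptyI finite.insertI)
  then have "finite {xs :: bit list. set xs \<subseteq> UNIV \<and> length xs = n}"
    by (rule finite_lists_length_eq)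
  moreover have "carrier_vec n \<subseteq> vec_of_list ` {xs :: bit list. set xs \<subseteq> UNIV \<and> length xs = n}"
    by (auto intro!: image_eqI[where x = "list_of_vec _"] simp: vec_list)
  ultimately show ?thesis by (meson finite_imageI finite_subset)
qed

lemma finite_carrier_mat_bit: "finite (carrier_mat nr nc :: bit Matrix.mat set)"
proof -
  have "finite {vs :: bit Matrix.vec list. set vs \<subseteq> carrier_vec nc \<and> length vs = nr}"
    by (rule finite_lists_length_eq[OF finite_carrier_vec_bit])
  moreover have "(carrier_mat nr nc :: bit Matrix.mat set) \<subseteq>
      mat_of_rows nc ` {vs. set vs \<subseteq> carrier_vec nc \<and> length vs = nr}"
  proof
    fix M :: "bit Matrix.mat" assume M: "M \<in> carrier_mat nr nc"
    then have "M = mat_of_rows nc (rows M)" by (metis carrier_matD(2) mat_of_rows_rows)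
    moreover have "set (rows M) \<subseteq> carrier_vec nc" "length (rows M) = nr"
      using M rows_carrier[of M] by auto
    ultimately show "M \<in> mat_of_rows nc ` {vs. set vs \<subseteq> carrier_vec nc \<and> length vs = nr}"
      by blast
  qed
  ultimately show ?thesis by (meson finite_imageI finite_subset)
qed

lemma finite_bitstrings: "finite (bitstrings l)"
  using finite_lists_length_eq[of "UNIV :: bool set" l] by (simp add: bitstrings_def)

lemma card_bitstrings: "card (bitstrings l) = 2 ^ l"
  using card_lists_length_eq[of "UNIV :: bool set" l] by (simp add: bitstrings_def)

lemma bitstrings_nonempty: "bitstrings l \<noteq> {}"
  using card_bitstrings[of l] by fastforce

lemma finite_Perm: "finite (Perm n)" and Perm_nonempty: "Perm n \<noteq> {}"
  using finite_permutations[of "{..<n}"] permutes_id[of "{..<n}"] unfolding Perm_def by blast+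

lemma finite_words_of_weight: "finite (words_of_weight n w)"
  by (rule finite_subset[OF _ finite_carrier_vec_bit[of n]]) (auto simp: words_of_weight_def)

lemma words_of_weight_nonempty:
  assumes "w \<le> n"
  shows "words_of_weight n w \<noteq> {}"
proof -
  let ?v = "Matrix.vec n (\<lambda>i. if i < w then 1 else 0 :: bit)"
  have "{i. i < n \<and> ?v $ i \<noteq> 0} = {..<w}" using assms by (auto split: if_splits)
  then have "?v \<in> words_of_weight n w" by (simp add: words_of_weight_def wt_def)
  then show ?thesis by blast
qed

lemma finite_challenges: "finite (challenges R)"
  using finite_lists_length_eq[of "{1, 2, 3 :: nat}" R] by (simp add: challenges_def conj_commute)

lemma challenges_nonempty: "challenges R \<noteq> {}"
proof -
  have "replicate R 1 \<in> challenges R" by (auto simp: challenges_def)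
  then show ?thesis by blast
qed

text \<open>
  A set that is not measurable has \<open>measure\<close> zero, so measurability of the success event has content.
  It holds because every run depends on the sample through finitely many values only.
\<close>

definition observable :: "params \<Rightarrow> (world \<Rightarrow> 'a) \<Rightarrow> bool" where
  "observable pp h \<longleftrightarrow> simple_function (stern_space pp) (\<lambda>\<omega>. h (world_of \<omega>))"

lemma world_of_sel:
  "E0 (world_of \<omega>) = fst \<omega>"
  "E1 (world_of \<omega>) = fst (snd \<omega>)"
  "E2 (world_of \<omega>) = fst (snd (snd \<omega>))"
  "Hcomm (world_of \<omega>) = fst (snd (snd (snd \<omega>)))"
  "Hfs (world_of \<omega>) = fst (snd (snd (snd (snd \<omega>))))"
  "parity (world_of \<omega>) = fst (snd (snd (snd (snd (snd \<omega>)))))"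
  "secret (world_of \<omega>) = fst (snd (snd (snd (snd (snd (snd \<omega>))))))"
  "fresh (world_of \<omega>) = snd (snd (snd (snd (snd (snd (snd \<omega>))))))"
  by (cases \<omega> rule: world_of.cases, simp)+

lemma observable_oracles:
  "observable pp (\<lambda>W. E0 W b)" "observable pp (\<lambda>W. E1 W b)" "observable pp (\<lambda>W. E2 W b)"
  "observable pp (\<lambda>W. Hcomm W d)" "observable pp (\<lambda>W. Hfs W b)"
  "observable pp (\<lambda>W. parity W)" "observable pp (\<lambda>W. secret W)" "observable pp (\<lambda>W. fresh W ij)"
proof -
  let ?seeds = "bitstrings (seed_length pp)"
  let ?n = "code_length pp"
  let ?M = "stern_space pp"
  have "fst \<in> measurable ?M (random_function ?seeds (?seeds \<times> ?seeds))"
    "(\<lambda>\<omega>. fst (snd \<omega>)) \<in> measurable ?M (random_function ?seeds (Perm ?n))"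
    "(\<lambda>\<omega>. fst (snd (snd \<omega>))) \<in> measurable ?M (random_function ?seeds (carrier_vec ?n))"
    "(\<lambda>\<omega>. fst (snd (snd (snd \<omega>)))) \<in> measurable ?M (random_function UNIV (bitstrings (2 * sec_param pp)))"
    "(\<lambda>\<omega>. fst (snd (snd (snd (snd \<omega>))))) \<in> measurable ?M (random_function UNIV (challenges (rounds pp)))"
    "(\<lambda>\<omega>. fst (snd (snd (snd (snd (snd \<omega>)))))) \<in>
       measurable ?M (uniform_count_measure (carrier_mat (?n - code_dim pp) ?n))"
    "(\<lambda>\<omega>. fst (snd (snd (snd (snd (snd (snd \<omega>))))))) \<in>
       measurable ?M (uniform_count_measure (words_of_weight ?n (weight pp)))"
    "(\<lambda>\<omega>. snd (snd (snd (snd (snd (snd (snd \<omega>))))))) \<in> measurable ?M (random_function UNIV ?seeds)"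
    unfolding stern_space_def Let_def by measurable
  note this[THEN simple_function_measurable_compose[rotated]]
  note comp = this(1)[where f = "\<lambda>f. f b"] this(2)[where f = "\<lambda>f. f b"] this(3)[where f = "\<lambda>f. f b"]
    this(4)[where f = "\<lambda>f. f d"] this(5)[where f = "\<lambda>f. f b"]
    this(6)[where f = "\<lambda>x. x"] this(7)[where f = "\<lambda>x. x"] this(8)[where f = "\<lambda>f. f ij"]
  show "observable pp (\<lambda>W. E0 W b)" "observable pp (\<lambda>W. E1 W b)" "observable pp (\<lambda>W. E2 W b)"
    "observable pp (\<lambda>W. Hcomm W d)" "observable pp (\<lambda>W. Hfs W b)" "observable pp (\<lambda>W. parity W)"
    "observable pp (\<lambda>W. secret W)" "observable pp (\<lambda>W. fresh W ij)"
    unfolding observable_def world_of_sel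
    by (intro comp simple_function_random_function simple_function_uniform finite_cartesian_product
        finite_bitstrings finite_Perm finite_carrier_vec_bit finite_carrier_mat_bit
        finite_words_of_weight finite_challenges)+
qed

section \<open>Observability of the scheme and of arbitrary runs\<close>

lemma observable_const: "observable pp (\<lambda>W. x)"
  by (simp add: observable_def)

lemma observable_apply: "observable pp f \<Longrightarrow> observable pp (\<lambda>W. g (f W))"
  unfolding observable_def by (rule simple_function_apply)

lemma observable_apply2:
  "observable pp f \<Longrightarrow> observable pp g \<Longrightarrow> observable pp (\<lambda>W. h (f W) (g W))"
  unfolding observable_def by (rule simple_function_apply2)

lemma observable_bind:
  "observable pp f \<Longrightarrow> (\<And>y. observable pp (g y)) \<Longrightarrow> observable pp (\<lambda>W. g (f W) W)"
  unfolding observable_def by (rule simple_function_bind[where g = "\<lambda>y \<omega>. g y (world_of \<omega>)"])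

lemma observable_map:
  "(\<And>a. observable pp (\<lambda>W. f W a)) \<Longrightarrow> observable pp (\<lambda>W. map (f W) as)"
  unfolding observable_def by (rule simple_function_map[where f = "\<lambda>a \<omega>. f (world_of \<omega>) a"])

lemma observable_seed_perm: "observable pp (\<lambda>W. seed_perm W sd)"
  unfolding seed_perm_def
  by (rule observable_bind[where f = "\<lambda>W. E0 W sd" and g = "\<lambda>y W. E1 W (fst y)"];
      rule observable_oracles)

lemma observable_seed_mask: "observable pp (\<lambda>W. seed_mask W sd)"
  unfolding seed_mask_def
  by (intro observable_apply2[where h = "\<lambda>\<pi>. act (Hilbert_Choice.inv \<pi>)"] observable_seed_perm
      observable_bind[where f = "\<lambda>W. E0 W sd" and g = "\<lambda>y W. E2 W (snd y)"] observable_oracles)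

lemma observable_committed: "observable pp (\<lambda>W. committed W sd i)"
proof -
  have "observable pp (\<lambda>W. ((seed_perm W sd, seed_mask W sd), (parity W, secret W)))"
    by (intro observable_apply2[where h = Pair] observable_seed_perm observable_seed_mask
        observable_oracles)
  from observable_apply[OF this, of "\<lambda>((\<pi>, y), (H, e)).
      if i = 1 then DTup [DPerm \<pi>, DVec (H *\<^sub>v y)]
      else if i = 2 then DVec (act \<pi> y)
      else DVec (act \<pi> (y + e))"]
  show ?thesis by (simp add: committed_def Let_def)
qed

lemma observable_commitment: "observable pp (\<lambda>W. commitment W sd i)"
  unfolding commitment_def
  by (rule observable_bind[where g = "\<lambda>d W. Hcomm W d", OF observable_committed observable_oracles(4)])

lemma observable_response: "observable pp (\<lambda>W. response W sd i)"
proof -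
  have "observable pp (\<lambda>W. ((E0 W sd, seed_perm W sd), (seed_mask W sd, secret W)))"
    by (intro observable_apply2[where h = Pair] observable_seed_perm observable_seed_mask
        observable_oracles)
  from observable_apply[OF this, of "\<lambda>((s, \<pi>), (y, e)).
      if i = 1 then DTup [DBits (snd s), DVec (act \<pi> e)]
      else if i = 2 then DTup [DBits (fst s), DVec (y + e)]
      else DBits sd"]
  show ?thesis by (simp add: response_def Let_def)
qed

lemma observable_digest: "observable pp (\<lambda>W. digest W sds)"
proof -
  have "observable pp (\<lambda>W. map (\<lambda>i. DBits (commitment W sd i)) [1, 2, 3])" for sd
    by (intro observable_map observable_apply[where g = DBits] observable_commitment)
  then have "observable pp (\<lambda>W. map (\<lambda>sd. map (\<lambda>i. DBits (commitment W sd i)) [1, 2, 3]) sds)"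
    by (rule observable_map)
  from observable_apply[OF this, of "\<lambda>ds. DTup (concat ds)"]
  show ?thesis unfolding digest_def
    by (rule observable_bind[where g = "\<lambda>d W. Hcomm W d", OF _ observable_oracles(4)])
qed

text \<open>The digest and the challenges are first fixed to \<open>x\<close> and \<open>cs\<close>,
  then bound one after the other: the challenges for fixed \<open>x\<close>, and finally the
  digest.\<close>

lemma observable_signature: "observable pp (\<lambda>W. signature W sds m)"
proof -
  have "observable pp (\<lambda>W. map (\<lambda>p. DBits (commitment W (fst p) (snd p))) (zip sds cs))"
    "observable pp (\<lambda>W. map (\<lambda>p. response W (fst p) (snd p)) (zip sds cs))" for cs
    by (intro observable_map observable_apply[where g = DBits] observable_commitment
        observable_response)+
  then have "observable pp (\<lambda>W. DTup [DBits x,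
      DTup (map2 (\<lambda>sd c. DBits (commitment W sd c)) sds cs),
      DTup (map2 (\<lambda>sd c. response W sd c) sds cs)])" for x cs
    unfolding split_def
    by (rule observable_apply2[where h = "\<lambda>a b. DTup [DBits x, DTup a, DTup b]"])
  then have "observable pp (\<lambda>W. DTup [DBits x,
      DTup (map2 (\<lambda>sd c. DBits (commitment W sd c)) sds (Hfs W (x @ m))),
      DTup (map2 (\<lambda>sd c. response W sd c) sds (Hfs W (x @ m)))])" for x
    by (rule observable_bind[OF observable_oracles(5)[of pp "x @ m"]])
  then show ?thesis
    unfolding signature_def Let_def digest_def[symmetric]
    by (rule observable_bind[OF observable_digest])
qed

text \<open>The configuration is fixed here, so only oracle calls and \<open>Sign\<close> involve
  the world.\<close>

lemma observable_exec: "observable pp (\<lambda>W. exec pp W ins c)"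
proof (cases ins)
  case (Eval_E0 r a)
  show ?thesis unfolding Eval_E0 exec.simps
    by (rule observable_apply[OF observable_oracles(1)])
next
  case (Eval_E1 r a)
  show ?thesis unfolding Eval_E1 exec.simps
    by (rule observable_apply[OF observable_oracles(2)])
next
  case (Eval_E2 r a)
  show ?thesis unfolding Eval_E2 exec.simps
    by (rule observable_apply[OF observable_oracles(3)])
next
  case (Eval_Hcomm r a)
  show ?thesis unfolding Eval_Hcomm exec.simps
    by (rule observable_apply[OF observable_oracles(4)])
next
  case (Eval_Hfs r a)
  show ?thesis unfolding Eval_Hfs exec.simps
    by (rule observable_apply[OF observable_oracles(5)])
next
  case (Sign r a)
  have "observable pp (\<lambda>W. map (\<lambda>j. fresh W (queries c, j)) [0..<rounds pp])"
    by (rule observable_map[OF observable_oracles(8)])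
  from observable_bind[where g = "\<lambda>sds W. signature W sds (as_bits (mem c a))",
      OF this observable_signature]
  show ?thesis unfolding Sign exec.simps by (rule observable_apply)
qed (simp_all add: observable_const)

text \<open>At time \<open>t\<close> only finitely many configurations are possible, so it suffices
  that the next step is observable from each fixed one.\<close>

lemma observable_run: "observable pp (\<lambda>W. run pp W A t)"
proof (induction t)
  case 0
  have "observable pp (\<lambda>W. parity W *\<^sub>v secret W)"
    by (rule observable_apply2[OF observable_oracles(6,7)])
  from observable_apply2[OF observable_oracles(6) this, where
      h = "\<lambda>M s. \<lparr>pc = 0, mem = proj (inputs pp M s), table = Map.empty, queries = 0, answer = None\<rparr>"]
  show ?case by (simp add: run_def start_def syndrome_def)
next
  case (Suc t)
  have "observable pp (\<lambda>W. step pp W A c)" for c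
    unfolding step_def by (cases "answer c \<noteq> None \<or> length A \<le> pc c")
      (auto simp: observable_const observable_exec)
  from observable_bind[OF Suc this] show ?case by (simp add: run_def)
qed

lemma sets_success:
  "{\<omega> \<in> space (stern_space pp).
      \<exists>t. answer (run pp (world_of \<omega>) A t) = Some (DVec (secret (world_of \<omega>)))} \<in> sets (stern_space pp)"
proof -
  have "observable pp (\<lambda>W. answer (run pp W A t) = Some (DVec (secret W)))" for t
    by (rule observable_apply2[OF observable_run observable_oracles(7),
          where h = "\<lambda>c e. answer c = Some (DVec e)"])
  then have "{\<omega> \<in> space (stern_space pp).
      answer (run pp (world_of \<omega>) A t) = Some (DVec (secret (world_of \<omega>)))} \<in> sets (stern_space pp)" for t
    unfolding observable_def by (rule simple_function_Collect)
  then have "(\<Union>t. {\<omega> \<in> space (stern_space pp).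
      answer (run pp (world_of \<omega>) A t) = Some (DVec (secret (world_of \<omega>)))}) \<in> sets (stern_space pp)"
    by blast
  moreover have "(\<Union>t. {\<omega> \<in> space (stern_space pp).
      answer (run pp (world_of \<omega>) A t) = Some (DVec (secret (world_of \<omega>)))}) =
    {\<omega> \<in> space (stern_space pp).
      \<exists>t. answer (run pp (world_of \<omega>) A t) = Some (DVec (secret (world_of \<omega>)))}"
    by blast
  ultimately show ?thesis by simp
qed

section \<open>Probability of success\<close>

lemma emeasure_pair_ge_const:
  assumes "prob_space M1" "prob_space M2" "X \<in> sets (M1 \<Otimes>\<^sub>M M2)"
    and "\<And>x. x \<in> space M1 \<Longrightarrow> k \<le> emeasure M2 (Pair x -` X)"
  shows "k \<le> emeasure (M1 \<Otimes>\<^sub>M M2) X"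
proof -
  interpret M1: prob_space M1 by fact
  interpret M2: prob_space M2 by fact
  have "k = (\<integral>\<^sup>+ x. k \<partial>M1)" by (simp add: M1.emeasure_space_1)
  also have "\<dots> \<le> (\<integral>\<^sup>+ x. emeasure M2 (Pair x -` X) \<partial>M1)"
    by (rule nn_integral_mono) (rule assms(4))
  also have "\<dots> = emeasure (M1 \<Otimes>\<^sub>M M2) X"
    using assms(3) by (simp add: M2.emeasure_pair_measure_alt)
  finally show ?thesis .
qed

text \<open>Integrates with the second factor outermost, so that the first one, later
  \<open>Hfs\<close> or \<open>E0\<close>, is averaged while the other is fixed.\<close>

lemma emeasure_pair_ge_snd:
  assumes "prob_space M1" "prob_space M2" "X \<in> sets (M1 \<Otimes>\<^sub>M M2)" "A \<in> sets M2"
    and "\<And>y. y \<in> A \<Longrightarrow> k \<le> emeasure M1 ((\<lambda>x. (x, y)) -` X)"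
  shows "k * emeasure M2 A \<le> emeasure (M1 \<Otimes>\<^sub>M M2) X"
proof -
  interpret M1: prob_space M1 by fact
  interpret M2: prob_space M2 by fact
  interpret pair_sigma_finite M1 M2 ..
  have "k * emeasure M2 A = (\<integral>\<^sup>+ y. k * indicator A y \<partial>M2)"
    using assms(4) by (simp add: nn_integral_cmult_indicator)
  also have "\<dots> \<le> (\<integral>\<^sup>+ y. emeasure M1 ((\<lambda>x. (x, y)) -` X) \<partial>M2)"
    by (rule nn_integral_mono) (auto simp: indicator_def assms(5))
  also have "\<dots> = emeasure (M1 \<Otimes>\<^sub>M M2) X"
    using assms(3) by (simp add: emeasure_pair_measure_alt2)
  finally show ?thesis .
qed

text \<open>
  With \<open>M1\<close>, \<open>M5\<close>, \<open>M8\<close> the laws of \<open>E0\<close>, \<open>Hfs\<close> and the seeds: the challenge of a round is an \<open>Hfs\<close> value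
  at a point that depends on all other coordinates, so it is averaged before anything else.
\<close>

lemma emeasure_product8_ge:
  assumes p: "prob_space M1" "prob_space M2" "prob_space M3" "prob_space M4"
    "prob_space M5" "prob_space M6" "prob_space M7" "prob_space M8"
    and X: "X \<in> sets (M1 \<Otimes>\<^sub>M M2 \<Otimes>\<^sub>M M3 \<Otimes>\<^sub>M M4 \<Otimes>\<^sub>M M5 \<Otimes>\<^sub>M M6 \<Otimes>\<^sub>M M7 \<Otimes>\<^sub>M M8)"
    and D: "D \<in> sets (M1 \<Otimes>\<^sub>M M8)"
    and c: "\<And>a1 a2 a3 a4 a6 a7 a8. \<lbrakk>a1 \<in> space M1; a2 \<in> space M2; a3 \<in> space M3; a4 \<in> space M4;
       a6 \<in> space M6; a7 \<in> space M7; a8 \<in> space M8; (a1, a8) \<in> D\<rbrakk> \<Longrightarrow>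
       c \<le> emeasure M5 {a5 \<in> space M5. (a1, a2, a3, a4, a5, a6, a7, a8) \<in> X}"
  shows "c * emeasure (M1 \<Otimes>\<^sub>M M8) D
    \<le> emeasure (M1 \<Otimes>\<^sub>M M2 \<Otimes>\<^sub>M M3 \<Otimes>\<^sub>M M4 \<Otimes>\<^sub>M M5 \<Otimes>\<^sub>M M6 \<Otimes>\<^sub>M M7 \<Otimes>\<^sub>M M8) X"
proof -
  note q = p prob_space_pair
  let ?Q = "M6 \<Otimes>\<^sub>M M7 \<Otimes>\<^sub>M M8"
  let ?rest = "M2 \<Otimes>\<^sub>M M3 \<Otimes>\<^sub>M M4 \<Otimes>\<^sub>M M5 \<Otimes>\<^sub>M ?Q"
  interpret M8: prob_space M8 by fact
  interpret rest: prob_space ?rest by (intro q)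
  \<comment> \<open>For fixed \<open>a1\<close>, coordinates 2 to 4 leave the bound unchanged; then
    coordinate 5 is averaged inside the integral over coordinates 6 to 8, restricted to those with
    \<open>(a1, a8)\<close> in \<open>D\<close>.\<close>
  have slice: "c * emeasure M8 (Pair a1 -` D) \<le> emeasure ?rest (Pair a1 -` X)"
    if a1: "a1 \<in> space M1" for a1
  proof (intro emeasure_pair_ge_const[of M2] emeasure_pair_ge_const[of M3]
      emeasure_pair_ge_const[of M4] q sets_Pair1[OF X]
      sets_Pair1[OF sets_Pair1[OF X]] sets_Pair1[OF sets_Pair1[OF sets_Pair1[OF X]]])
    fix a2 a3 a4
    assume a: "a2 \<in> space M2" "a3 \<in> space M3" "a4 \<in> space M4"
    let ?Y = "Pair a4 -` Pair a3 -` Pair a2 -` Pair a1 -` X"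
    let ?A = "{b \<in> space ?Q. (a1, snd (snd b)) \<in> D}"
    have Y: "?Y \<in> sets (M5 \<Otimes>\<^sub>M ?Q)"
      by (rule sets_Pair1[OF sets_Pair1[OF sets_Pair1[OF sets_Pair1[OF X]]]])
    have D1: "Pair a1 -` D \<in> sets M8" by (rule sets_Pair1[OF D])
    have A: "?A \<in> sets ?Q"
    proof -
      have "(\<lambda>b. snd (snd b)) \<in> measurable ?Q M8" by measurable
      from measurable_sets[OF this D1] show ?thesis by (simp add: vimage_def Int_def conj_commute)
    qed
    \<comment> \<open>Coordinates 6 and 7 do not enter \<open>D\<close>, so the cylinder
      \<open>?A\<close> is at least as likely as its base.\<close>
    have "emeasure M8 (Pair a1 -` D) \<le> emeasure ?Q ?A"
    proof (intro emeasure_pair_ge_const q sets_Pair1[OF A] A)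
      fix a6 a7 assume "a6 \<in> space M6" "a7 \<in> space M7"
      then have "Pair a7 -` Pair a6 -` ?A = Pair a1 -` D"
        using sets.sets_into_space[OF D1] by (auto simp: space_pair_measure)
      then show "emeasure M8 (Pair a1 -` D) \<le> emeasure M8 (Pair a7 -` Pair a6 -` ?A)" by simp
    qed
    then have "c * emeasure M8 (Pair a1 -` D) \<le> c * emeasure ?Q ?A"
      by (rule mult_left_mono) simp
    also have "\<dots> \<le> emeasure (M5 \<Otimes>\<^sub>M ?Q) ?Y"
    proof (intro emeasure_pair_ge_snd q Y A)
      fix b assume "b \<in> ?A"
      then obtain a6 a7 a8 where b: "b = (a6, a7, a8)" "a6 \<in> space M6" "a7 \<in> space M7"
        "a8 \<in> space M8" "(a1, a8) \<in> D"
        by (auto simp: space_pair_measure)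
      have "(\<lambda>a5. (a5, b)) -` ?Y = {a5 \<in> space M5. (a1, a2, a3, a4, a5, a6, a7, a8) \<in> X}"
        using sets.sets_into_space[OF X] by (auto simp: b(1) space_pair_measure)
      then show "c \<le> emeasure M5 ((\<lambda>a5. (a5, b)) -` ?Y)" using c a1 a b by simp
    qed
    finally show "c * emeasure M8 (Pair a1 -` D) \<le> emeasure (M5 \<Otimes>\<^sub>M ?Q) ?Y" .
  qed
  have "c * emeasure (M1 \<Otimes>\<^sub>M M8) D = (\<integral>\<^sup>+ a1. c * emeasure M8 (Pair a1 -` D) \<partial>M1)"
    using D by (simp add: M8.emeasure_pair_measure_alt nn_integral_cmult M8.measurable_emeasure_Pair)
  also have "\<dots> \<le> (\<integral>\<^sup>+ a1. emeasure ?rest (Pair a1 -` X) \<partial>M1)"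
    by (rule nn_integral_mono) (rule slice)
  also have "\<dots> = emeasure (M1 \<Otimes>\<^sub>M ?rest) X"
    using X by (simp add: rest.emeasure_pair_measure_alt)
  finally show ?thesis .
qed

lemma emeasure_random_function_Collect:
  assumes B: "finite B" "B \<noteq> {}" and J: "J \<subseteq> A" "finite J" "\<And>a. a \<in> J \<Longrightarrow> X a \<subseteq> B"
  shows "emeasure (random_function A B) {f \<in> space (random_function A B). \<forall>a\<in>J. f a \<in> X a} =
    (\<Prod>a\<in>J. ennreal (card (X a) / card B))"
proof -
  interpret U: prob_space "uniform_count_measure B"
    using B by (rule prob_space_uniform_count_measure)
  interpret product_prob_space "\<lambda>_. uniform_count_measure B" A ..
  show ?thesis
    using assms unfolding random_function_def
    by (subst emeasure_PiM_Collect)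
      (auto simp: sets_uniform_count_measure emeasure_uniform_count_measure)
qed

lemma measure_random_function_Collect:
  assumes "finite B" "B \<noteq> {}" "J \<subseteq> A" "finite J" "\<And>a. a \<in> J \<Longrightarrow> X a \<subseteq> B"
  shows "measure (random_function A B) {f \<in> space (random_function A B). \<forall>a\<in>J. f a \<in> X a} =
    (\<Prod>a\<in>J. card (X a) / card B)"
proof (rule measure_eq_emeasure_eq_ennreal)
  show "emeasure (random_function A B) {f \<in> space (random_function A B). \<forall>a\<in>J. f a \<in> X a} =
      ennreal (\<Prod>a\<in>J. card (X a) / card B)"
    using emeasure_random_function_Collect[of B J A X] assms by (simp add: prod_ennreal)
qed (simp add: prod_nonneg)

lemma sets_random_function_Collect2:
  assumes "finite B"
  shows "{f \<in> space (random_function A B). P (f a) (f b)} \<in> sets (random_function A B)"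
  by (rule simple_function_Collect, rule simple_function_apply2[where h = P])
    (rule simple_function_random_function[OF assms])+

section \<open>Sizes of the guess set and of the budget\<close>

lemma inj_on_to_bits: "inj_on (to_bits l) {..<2 ^ l}"
proof (rule inj_onI)
  fix i i' :: nat
  assume "i \<in> {..<2 ^ l}" "i' \<in> {..<2 ^ l}" and eq: "to_bits l i = to_bits l i'"
  then have t: "take_bit l i = i" "take_bit l i' = i'" by (auto simp: take_bit_nat_eq_self_iff)
  have "bit i j = bit i' j" if "j < l" for j
    using arg_cong[OF eq, of "\<lambda>bs. bs ! j"] that by (simp add: to_bits_def bit_iff_odd)
  then have "take_bit l i = take_bit l i'"
    by (intro bit_eqI) (auto simp: bit_take_bit_iff)
  then show "i = i'" using t by simp
qed

lemma guesses_subset: "guesses pp \<subseteq> bitstrings (seed_length pp)"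
  by (auto simp: guesses_def guess_def to_bits_def bitstrings_def)

text \<open>Rounding \<open>l / 2\<close> down to \<open>l div 2\<close> costs at most a factor 2 in
  the square of the budget.\<close>

lemma budget_square: "budget pp * budget pp \<le> 2 ^ seed_length pp"
  "2 ^ seed_length pp \<le> 2 * (budget pp * budget pp)"
proof -
  have b: "budget pp * budget pp = 2 ^ (2 * (seed_length pp div 2))"
    by (simp add: budget_def power_add[symmetric] mult_2)
  show "budget pp * budget pp \<le> 2 ^ seed_length pp"
    unfolding b by (rule power_increasing) auto
  have "2 ^ seed_length pp \<le> (2::nat) ^ Suc (2 * (seed_length pp div 2))"
    by (rule power_increasing) linarith+
  then show "2 ^ seed_length pp \<le> 2 * (budget pp * budget pp)" by (simp add: b)
qed

lemma card_guesses: "card (guesses pp) = guess_count pp"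
proof -
  have "1 \<le> budget pp" by (simp add: budget_def)
  then have "guess_count pp \<le> budget pp * budget pp"
    unfolding guess_count_def by (metis One_nat_def add_le_mono div_le_mono le_trans
        mult_2 mult_le_mono nat_mult_1 nonzero_mult_div_cancel_left zero_neq_numeral order_refl)
  then have "guess_count pp \<le> 2 ^ seed_length pp" using budget_square(1)[of pp] by simp
  then have "inj_on (guess pp) {..<guess_count pp}"
    unfolding guess_def by (intro inj_on_subset[OF inj_on_to_bits]) auto
  then show ?thesis by (simp add: guesses_def card_image)
qed

text \<open>For \<open>l \<ge> 2\<close> the budget is even and halving is exact. For
  \<open>l = 1\<close> both counts are 1, and \<open>2 \<le> 2 ^ 1\<close>. For \<open>l = 0\<close>
  the bound fails, hence the hypothesis.\<close>

lemma guess_count_budget_upper: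
  assumes "seed_length pp \<noteq> 0"
  shows "2 * (guess_count pp * budget pp) \<le> 2 ^ seed_length pp"
proof (cases "seed_length pp div 2")
  case 0
  then have "budget pp = 1" by (simp add: budget_def)
  moreover have "(2::nat) ^ 1 \<le> 2 ^ seed_length pp"
    by (rule power_increasing) (use assms in auto)
  ultimately show ?thesis by (simp add: guess_count_def)
next
  case (Suc h)
  then have "2 * guess_count pp = budget pp" by (simp add: guess_count_def budget_def)
  then show ?thesis using budget_square(1)[of pp] by (simp add: mult.assoc[symmetric])
qed

text \<open>Origin of the \<open>1 / 4\<close> in the birthday bound: a factor 2 from halving the
  guesses and a factor 2 from \<open>l div 2\<close>.\<close>

lemma guess_count_budget_lower: "2 ^ seed_length pp \<le> 4 * (guess_count pp * budget pp)"
proof -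
  have "budget pp \<le> 2 * guess_count pp" unfolding guess_count_def by linarith
  then have "budget pp * budget pp \<le> 2 * (guess_count pp * budget pp)"
    by (metis mult.assoc mult_le_mono1)
  then show ?thesis using budget_square(2)[of pp] by linarith
qed

section \<open>False matches and the use of a guessed seed\<close>

abbreviation E0_space :: "params \<Rightarrow> (bitstring \<Rightarrow> bitstring \<times> bitstring) measure" where
  "E0_space pp \<equiv> random_function (bitstrings (seed_length pp))
     (bitstrings (seed_length pp) \<times> bitstrings (seed_length pp))"

abbreviation fresh_space :: "params \<Rightarrow> (nat \<times> nat \<Rightarrow> bitstring) measure" where
  "fresh_space pp \<equiv> random_function UNIV (bitstrings (seed_length pp))"

text \<open>The event is split by the common value \<open>v\<close>. As \<open>s\<close> and
  \<open>s'\<close> are distinct, both take it with probability \<open>(1 / 2 ^ l)^2\<close>, and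
  there are \<open>2 ^ l\<close> values.\<close>

lemma prob_snd_collision:
  assumes "s \<in> bitstrings (seed_length pp)" "s' \<in> bitstrings (seed_length pp)" "s \<noteq> s'"
  shows "measure (E0_space pp) {f \<in> space (E0_space pp). snd (f s) = snd (f s')} =
    1 / 2 ^ seed_length pp"
proof -
  let ?S = "bitstrings (seed_length pp)"
  have fin: "finite (?S \<times> ?S)" "?S \<times> ?S \<noteq> {}"
    using finite_bitstrings bitstrings_nonempty by auto
  interpret prob_space "E0_space pp" using fin by (rule prob_space_random_function)
  let ?X = "\<lambda>v. {f \<in> space (E0_space pp). \<forall>a\<in>{s, s'}. f a \<in> ?S \<times> {v}}"
  have X: "measure (E0_space pp) (?X v) = (1 / 2 ^ seed_length pp)\<^sup>2" if "v \<in> ?S" for v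
    by (subst measure_random_function_Collect)
      (use assms fin that in \<open>auto simp: card_bitstrings card_cartesian_product power2_eq_square\<close>)
  have "{f \<in> space (E0_space pp). snd (f s) = snd (f s')} = (\<Union>v\<in>?S. ?X v)"
    using assms by (fastforce simp: space_random_function PiE_iff mem_Times_iff)
  also have "measure (E0_space pp) \<dots> = (\<Sum>v\<in>?S. measure (E0_space pp) (?X v))"
  proof (rule finite_measure_finite_Union)
    show "?X ` ?S \<subseteq> sets (E0_space pp)"
    proof (rule image_subsetI)
      fix v
      show "?X v \<in> sets (E0_space pp)"
        using sets_random_function_Collect2[OF fin(1), where P = "\<lambda>x y. x \<in> ?S \<times> {v} \<and> y \<in> ?S \<times> {v}" and a = s and b = s']
        by simp
    qed
    show "disjoint_family_on ?X ?S" by (auto simp: disjoint_family_on_def)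
  qed (rule finite_bitstrings)
  also have "\<dots> = (\<Sum>v\<in>?S. (1 / 2 ^ seed_length pp)\<^sup>2)"
    by (intro sum.cong X refl)
  also have "\<dots> = 1 / 2 ^ seed_length pp"
    by (simp add: card_bitstrings power2_eq_square)
  finally show ?thesis .
qed

lemma prob_no_false_match:
  assumes \<rho>: "\<rho> \<in> space (fresh_space pp)"
  shows "1 / 2 \<le> measure (E0_space pp) {f \<in> space (E0_space pp). no_false_match pp f \<rho>}"
proof -
  let ?S = "bitstrings (seed_length pp)"
  let ?f = "\<lambda>r. \<rho> (round_index pp r)"
  have fin: "finite (?S \<times> ?S)" "?S \<times> ?S \<noteq> {}"
    using finite_bitstrings bitstrings_nonempty by auto
  interpret prob_space "E0_space pp" using fin by (rule prob_space_random_function)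
  have f: "?f r \<in> ?S" for r using \<rho> by (auto simp: space_random_function)
  define I where "I = {(s, r). s \<in> guesses pp \<and> r < budget pp \<and> s \<noteq> ?f r}"
  have "I \<subseteq> guesses pp \<times> {..<budget pp}" by (auto simp: I_def)
  moreover have G: "finite (guesses pp)" by (simp add: guesses_def)
  ultimately have I: "finite I" "card I \<le> guess_count pp * budget pp"
    using card_mono[of "guesses pp \<times> {..<budget pp}" I]
    by (auto simp: card_cartesian_product card_guesses intro: finite_subset)
  let ?C = "\<lambda>(s, r). {f \<in> space (E0_space pp). snd (f s) = snd (f (?f r))}"
  have C: "?C ` I \<subseteq> events"
    using sets_random_function_Collect2[OF fin(1), where P = "\<lambda>x y. snd x = snd y"] by auto
  have "prob (\<Union>i\<in>I. ?C i) \<le> (\<Sum>i\<in>I. prob (?C i))"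
    using I(1) C by (rule finite_measure_subadditive_finite)
  also have "\<dots> = (\<Sum>i\<in>I. 1 / 2 ^ seed_length pp)"
  proof (rule sum.cong[OF refl])
    fix i assume "i \<in> I"
    then obtain s r where "i = (s, r)" "s \<in> guesses pp" "s \<noteq> ?f r" by (auto simp: I_def)
    then show "prob (?C i) = 1 / 2 ^ seed_length pp"
      using prob_snd_collision[of s pp "?f r"] guesses_subset f by auto
  qed
  also have "\<dots> \<le> 1 / 2"
  \<comment> \<open>With seed length 0 there is a single seed, hence no pair of different ones; this
    is the case that the count of pairs does not cover.\<close>
  proof (cases "seed_length pp = 0")
    case True
    then have "I = {}" using f guesses_subset[of pp] by (auto simp: I_def bitstrings_def)
    then show ?thesis by simp
  next
    case False
    have "real (2 * card I) \<le> real (2 ^ seed_length pp)"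
      using I(2) guess_count_budget_upper[OF False] by (intro of_nat_mono) linarith
    then show ?thesis by (simp add: field_simps)
  qed
  finally have le: "prob (\<Union>i\<in>I. ?C i) \<le> 1 / 2" .
  have "{f \<in> space (E0_space pp). no_false_match pp f \<rho>} = space (E0_space pp) - (\<Union>i\<in>I. ?C i)"
    by (fastforce simp: no_false_match_def I_def)
  then have "prob {f \<in> space (E0_space pp). no_false_match pp f \<rho>} = 1 - prob (\<Union>i\<in>I. ?C i)"
    using prob_compl[of "\<Union>i\<in>I. ?C i"] C I(1) by (simp add: sets.finite_UN image_subset_iff)
  then show ?thesis using le by simp
qed

lemma inj_round_index: "inj_on (round_index pp) A"
proof (rule inj_onI)
  fix r r' assume "round_index pp r = round_index pp r'"
  then have "r div rounds pp = r' div rounds pp" "r mod rounds pp = r' mod rounds pp"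
    by (simp_all add: round_index_def)
  then show "r = r'" by (metis div_mult_mod_eq)
qed

text \<open>The guesses are a fixed set and \<open>round_index\<close> is injective, so the rounds
  miss it independently: with \<open>g\<close> guesses and budget \<open>N\<close>,
  \<open>(1 - g / 2^l)^N \<le> exp (- g * N / 2^l)\<close>.\<close>

lemma prob_some_guess_used:
  "1 - exp (- 1 / 4) \<le> measure (fresh_space pp)
     {\<rho> \<in> space (fresh_space pp). \<exists>r<budget pp. \<rho> (round_index pp r) \<in> guesses pp}"
proof -
  let ?S = "bitstrings (seed_length pp)"
  let ?L = "2 ^ seed_length pp :: real"
  interpret prob_space "fresh_space pp"
    using finite_bitstrings bitstrings_nonempty by (rule prob_space_random_function)
  let ?J = "round_index pp ` {..<budget pp}"
  let ?hit = "{\<rho> \<in> space (fresh_space pp). \<exists>r<budget pp. \<rho> (round_index pp r) \<in> guesses pp}"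
  let ?miss = "{\<rho> \<in> space (fresh_space pp). \<forall>ij\<in>?J. \<rho> ij \<in> ?S - guesses pp}"
  have L: "guess_count pp \<le> 2 ^ seed_length pp"
    using card_mono[OF finite_bitstrings guesses_subset[of pp]]
    by (simp add: card_guesses card_bitstrings)
  have "prob ?miss = (\<Prod>ij\<in>?J. card (?S - guesses pp) / card ?S)"
    by (rule measure_random_function_Collect[OF finite_bitstrings bitstrings_nonempty]) auto
  also have "\<dots> = (1 - guess_count pp / ?L) ^ budget pp"
    using finite_subset[OF guesses_subset finite_bitstrings] L
    by (simp add: card_image inj_round_index card_Diff_subset guesses_subset card_guesses
        card_bitstrings of_nat_diff diff_divide_distrib)
  also have "\<dots> \<le> exp (- (guess_count pp / ?L)) ^ budget pp"
  proof (rule power_mono)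
    show "1 - guess_count pp / ?L \<le> exp (- (guess_count pp / ?L))"
      using exp_ge_add_one_self[of "- (guess_count pp / ?L)"] by simp
    have "real (guess_count pp) \<le> ?L" using L by (simp add: of_nat_mono[THEN order_trans])
    then show "0 \<le> 1 - guess_count pp / ?L" by simp
  qed
  also have "\<dots> = exp (- (guess_count pp * budget pp / ?L))"
    by (simp add: exp_of_nat_mult[symmetric] mult.commute)
  also have "\<dots> \<le> exp (- 1 / 4)"
  proof -
    have "real (2 ^ seed_length pp) \<le> real (4 * (guess_count pp * budget pp))"
      using guess_count_budget_lower by (rule of_nat_mono)
    then show ?thesis by (simp add: field_simps)
  qed
  finally have "prob ?miss \<le> exp (- 1 / 4)" .
  also have "?miss = space (fresh_space pp) - ?hit"
    by (auto simp: space_random_function)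
  finally have "prob (space (fresh_space pp) - ?hit) \<le> exp (- 1 / 4)" .
  moreover have "?hit \<in> events"
  proof (rule simple_function_Collect, rule simple_function_ex_less)
    fix r
    show "simple_function (fresh_space pp) (\<lambda>\<rho>. \<rho> (round_index pp r) \<in> guesses pp)"
      by (rule simple_function_apply[where g = "\<lambda>x. x \<in> guesses pp"])
        (rule simple_function_random_function[OF finite_bitstrings])
  qed
  then have "prob (space (fresh_space pp) - ?hit) = 1 - prob ?hit" by (rule prob_compl)
  ultimately show ?thesis by simp
qed

text \<open>Overwriting entry \<open>j\<close> by 1 and remembering its old value is injective, so
  fixing the entry shrinks the set by at most a factor 3.\<close>

lemma card_challenge_one:
  assumes "j < R"
  shows "card (challenges R) \<le> 3 * card {cs \<in> challenges R. cs ! j = 1}"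
proof -
  let ?A = "{cs \<in> challenges R. cs ! j = 1} \<times> {1, 2, 3 :: nat}"
  let ?f = "\<lambda>cs. (cs[j := 1], cs ! j)"
  have "inj_on ?f (challenges R)"
  proof (rule inj_onI)
    fix cs cs' assume "?f cs = ?f cs'"
    then show "cs = cs'" by (metis list_update_id list_update_overwrite prod.inject)
  qed
  moreover have "?f ` challenges R \<subseteq> ?A"
  proof (rule image_subsetI)
    fix cs assume cs: "cs \<in> challenges R"
    then have "cs ! j \<in> {1, 2, 3}"
      using assms nth_mem[of j cs] unfolding challenges_def by blast
    moreover have "cs[j := 1] \<in> challenges R"
      using cs set_update_subset_insert[of cs j 1] unfolding challenges_def by auto
    moreover have "cs[j := 1] ! j = 1" using cs assms by (simp add: challenges_def)
    ultimately show "?f cs \<in> ?A" by blast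
  qed
  moreover have "finite ?A" using finite_challenges[of R] by simp
  ultimately have "card (challenges R) \<le> card ?A" by (rule card_inj_on_le)
  then show ?thesis by (simp add: card_cartesian_product)
qed

lemma prob_challenge_one:
  assumes "j < R"
  shows "ennreal (1 / 3) \<le> emeasure (random_function UNIV (challenges R))
    {h \<in> space (random_function UNIV (challenges R)). h d ! j = 1}"
proof -
  let ?G = "{cs \<in> challenges R. cs ! j = 1}"
  have "{h \<in> space (random_function UNIV (challenges R)). h d ! j = 1} =
      {h \<in> space (random_function UNIV (challenges R)). \<forall>a\<in>{d}. h a \<in> ?G}"
    by (auto simp: space_random_function)
  also have "emeasure (random_function UNIV (challenges R)) \<dots> =
      ennreal (card ?G / card (challenges R))"
    using emeasure_random_function_Collect[OF finite_challenges challenges_nonempty,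
        of "{d}" UNIV "\<lambda>_. ?G"] by auto
  also have "\<dots> \<ge> ennreal (1 / 3)"
  proof (rule ennreal_leI)
    have "0 < card (challenges R)"
      using finite_challenges challenges_nonempty by (simp add: card_gt_0_iff)
    then show "1 / 3 \<le> card ?G / card (challenges R)"
      using card_challenge_one[OF assms] by (simp add: field_simps)
  qed
  finally show ?thesis .
qed

text \<open>Commitments are built from \<open>E0\<close>, \<open>E1\<close>, \<open>E2\<close>,
  \<open>Hcomm\<close> and the key only.\<close>

lemma digest_cong_Hfs:
  "digest (world_of (e0, e1, e2, hc, hf, M, e, \<rho>)) sds =
   digest (world_of (e0, e1, e2, hc, hf', M, e, \<rho>)) sds"
  by (simp add: digest_def commitment_def committed_def seed_perm_def seed_mask_def Let_def)

text \<open>Collects what success requires of \<open>E0\<close> and the seeds alone;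
  \<open>Hfs\<close> is absent, so its value at the digest is still uniform once a favourable pair
  is fixed.\<close>

definition favourable :: "params \<Rightarrow> ((bitstring \<Rightarrow> bitstring \<times> bitstring) \<times> (nat \<times> nat \<Rightarrow> bitstring)) set" where
  "favourable pp = {p \<in> space (E0_space pp \<Otimes>\<^sub>M fresh_space pp).
     no_false_match pp (fst p) (snd p) \<and>
     (\<exists>r<budget pp. snd p (round_index pp r) \<in> guesses pp)}"

lemma sets_favourable: "favourable pp \<in> sets (E0_space pp \<Otimes>\<^sub>M fresh_space pp)"
proof -
  let ?M = "E0_space pp \<Otimes>\<^sub>M fresh_space pp"
  let ?S = "bitstrings (seed_length pp)"
  have "finite (?S \<times> ?S)" using finite_bitstrings by auto
  then have e0: "simple_function ?M (\<lambda>p. fst p a)" for a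
    by (intro simple_function_measurable_compose[OF simple_function_random_function measurable_fst])
  have \<rho>: "simple_function ?M (\<lambda>p. snd p ij)" for ij
    by (intro finite_bitstrings
        simple_function_measurable_compose[OF simple_function_random_function measurable_snd])
  have used: "simple_function ?M (\<lambda>p. \<exists>r<budget pp. snd p (round_index pp r) \<in> guesses pp)"
    by (rule simple_function_ex_less) (rule simple_function_apply[OF \<rho>])
  \<comment> \<open>\<open>E0\<close> is evaluated at a random seed, which takes finitely many
    values.\<close>
  have e0\<rho>: "simple_function ?M (\<lambda>p. fst p (snd p ij))" for ij
    by (rule simple_function_bind[where f = "\<lambda>p. snd p ij" and g = "\<lambda>a p. fst p a", OF \<rho> e0])
  have *: "simple_function ?M (\<lambda>p. snd (fst p (guess pp i)) = snd (fst p (snd p ij)) \<and>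
      guess pp i \<noteq> snd p ij)" for i ij
    by (rule simple_function_apply2[where h = "(\<and>)"];
        (rule simple_function_apply2[OF e0 e0\<rho>, where h = "\<lambda>a b. snd a = snd b"]
         | rule simple_function_apply[OF \<rho>]))
  have false_match: "simple_function ?M (\<lambda>p. \<exists>i<guess_count pp. \<exists>r<budget pp.
      snd (fst p (guess pp i)) = snd (fst p (snd p (round_index pp r))) \<and>
      guess pp i \<noteq> snd p (round_index pp r))"
    by (rule simple_function_ex_less, rule simple_function_ex_less, rule *)
  have nfm: "no_false_match pp (fst p) (snd p) \<longleftrightarrow> \<not> (\<exists>i<guess_count pp. \<exists>r<budget pp.
      snd (fst p (guess pp i)) = snd (fst p (snd p (round_index pp r))) \<and>
      guess pp i \<noteq> snd p (round_index pp r))" for p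
    by (auto simp: no_false_match_def guesses_def)
  have "simple_function ?M (\<lambda>p. no_false_match pp (fst p) (snd p) \<and>
      (\<exists>r<budget pp. snd p (round_index pp r) \<in> guesses pp))"
    unfolding nfm by (rule simple_function_apply2[OF false_match used, of "\<lambda>a b. \<not> a \<and> b"])
  then show ?thesis unfolding favourable_def by (rule simple_function_Collect)
qed

text \<open>The bound on false matches holds for every fixed choice of the seeds, so it multiplies
  with the probability that a guess is used; the seeds are therefore the outer variable of
  integration.\<close>

lemma prob_favourable:
  "ennreal ((1 - exp (- 1 / 4)) / 2) \<le> emeasure (E0_space pp \<Otimes>\<^sub>M fresh_space pp) (favourable pp)"
proof -
  let ?S = "bitstrings (seed_length pp)"
  have fin: "finite (?S \<times> ?S)" "?S \<times> ?S \<noteq> {}"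
    using finite_bitstrings bitstrings_nonempty by auto
  interpret E: prob_space "E0_space pp" using fin by (rule prob_space_random_function)
  interpret F: prob_space "fresh_space pp"
    using finite_bitstrings bitstrings_nonempty by (rule prob_space_random_function)
  let ?hit = "{\<rho> \<in> space (fresh_space pp). \<exists>r<budget pp. \<rho> (round_index pp r) \<in> guesses pp}"
  have hit: "?hit \<in> F.events"
    by (rule simple_function_Collect, rule simple_function_ex_less,
        rule simple_function_apply[where g = "\<lambda>x. x \<in> guesses pp"],
        rule simple_function_random_function[OF finite_bitstrings])
  have "ennreal ((1 - exp (- 1 / 4)) / 2) = ennreal (1 / 2) * ennreal (1 - exp (- 1 / 4))"
    by (subst ennreal_mult[symmetric]) simp_all
  also have "\<dots> \<le> ennreal (1 / 2) * emeasure (fresh_space pp) ?hit"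
    unfolding F.emeasure_eq_measure using prob_some_guess_used
    by (intro mult_left_mono ennreal_leI) auto
  also have "\<dots> \<le> emeasure (E0_space pp \<Otimes>\<^sub>M fresh_space pp) (favourable pp)"
  proof (rule emeasure_pair_ge_snd[OF E.prob_space_axioms F.prob_space_axioms sets_favourable hit])
    fix \<rho> assume \<rho>: "\<rho> \<in> ?hit"
    then have "(\<lambda>x. (x, \<rho>)) -` favourable pp = {f \<in> space (E0_space pp). no_false_match pp f \<rho>}"
      by (auto simp: favourable_def space_pair_measure)
    then show "ennreal (1 / 2) \<le> emeasure (E0_space pp) ((\<lambda>x. (x, \<rho>)) -` favourable pp)"
      using \<rho> prob_no_false_match[of \<rho> pp] unfolding E.emeasure_eq_measure
      by (simp only: mem_Collect_eq) (intro ennreal_leI, blast)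
  qed
  finally show ?thesis .
qed

section \<open>The attack breaks the scheme\<close>

lemma attacked_world_of:
  assumes "valid_params pp" "\<omega> \<in> space (stern_space pp)"
  shows "attacked_world pp (world_of \<omega>)"
proof
  have E0: "E0 (world_of \<omega>) \<in> bitstrings (seed_length pp) \<rightarrow>\<^sub>E
        bitstrings (seed_length pp) \<times> bitstrings (seed_length pp)"
    and E1: "E1 (world_of \<omega>) \<in> bitstrings (seed_length pp) \<rightarrow>\<^sub>E Perm (code_length pp)"
    and Hfs: "Hfs (world_of \<omega>) \<in> UNIV \<rightarrow>\<^sub>E challenges (rounds pp)"
    and secret: "secret (world_of \<omega>) \<in> words_of_weight (code_length pp) (weight pp)"
    and fresh: "fresh (world_of \<omega>) \<in> UNIV \<rightarrow>\<^sub>E bitstrings (seed_length pp)"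
    using assms(2) unfolding stern_space_def Let_def world_of_sel space_pair_measure
      space_random_function space_uniform_count_measure mem_Times_iff by blast+
  show "E0 (world_of \<omega>) sd \<in> bitstrings (seed_length pp) \<times> bitstrings (seed_length pp)"
    "E1 (world_of \<omega>) sd \<in> Perm (code_length pp)" if "sd \<in> bitstrings (seed_length pp)" for sd
    using PiE_mem[OF E0 that] PiE_mem[OF E1 that] .
  show "Hfs (world_of \<omega>) b \<in> challenges (rounds pp)" for b
    using PiE_mem[OF Hfs] by simp
  show "fresh (world_of \<omega>) ij \<in> bitstrings (seed_length pp)" for ij
    using PiE_mem[OF fresh] by simp
  show "secret (world_of \<omega>) \<in> carrier_vec (code_length pp)"
    using secret by (simp add: words_of_weight_def)
qed (rule assms(1))

section \<open>Halting time, number of queries and success probability\<close>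

lemma run_halted:
  assumes "answer (run pp W A t) \<noteq> None" "t \<le> t'"
  shows "run pp W A t' = run pp W A t"
  using assms(2)
proof (induction t' rule: dec_induct)
  case (step u)
  have "run pp W A (Suc u) = Defs.step pp W A (run pp W A u)" by (simp add: run_def)
  then show ?case using step.IH assms(1) by (simp add: step_def)
qed simp

lemma queries_exec: "queries c \<le> queries (exec pp W ins c)"
  by (cases ins) (simp_all add: assign_def jump_def)

lemma queries_run_mono: "t \<le> t' \<Longrightarrow> queries (run pp W A t) \<le> queries (run pp W A t')"
proof (induction t' rule: dec_induct)
  case (step u)
  have "run pp W A (Suc u) = Defs.step pp W A (run pp W A u)" by (simp add: run_def)
  then have "queries (run pp W A u) \<le> queries (run pp W A (Suc u))"
    using queries_exec by (simp add: step_def)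
  then show ?case using step.IH by simp
qed simp

lemma budget_le: "real (budget pp) \<le> 2 powr (real (seed_length pp) / 2)"
proof -
  have "real (budget pp) = 2 powr real (seed_length pp div 2)"
    by (simp add: budget_def powr_realpow)
  also have "\<dots> \<le> 2 powr (real (seed_length pp) / 2)"
    by (intro powr_mono) linarith+
  finally show ?thesis .
qed

lemma halts_within_attack:
  assumes "valid_params pp"
  shows "halts_within pp attack (60 * 2 powr (real (seed_length pp) / 2))"
proof -
  have "answer (run pp (world_of \<omega>) attack (60 * budget pp)) \<noteq> None"
    if "\<omega> \<in> space (stern_space pp)" for \<omega>
  proof -
    interpret attacked_world pp "world_of \<omega>" using assms that by (rule attacked_world_of)
    obtain t where t: "t \<le> 60 * budget pp" "finished 0 (run pp (world_of \<omega>) attack t)"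
      using attack_run by blast
    from t(2) have halt: "answer (run pp (world_of \<omega>) attack t) \<noteq> None"
      unfolding finished_def by (rule conjunct1)
    show ?thesis unfolding run_halted[OF halt t(1)] by (rule halt)
  qed
  moreover have "real (60 * budget pp) \<le> 60 * 2 powr (real (seed_length pp) / 2)"
    using budget_le by simp
  ultimately show ?thesis
    unfolding halts_within_def by (intro exI[of _ "60 * budget pp"] conjI ballI)
qed

lemma queries_at_most_attack:
  assumes "valid_params pp"
  shows "queries_at_most pp attack
    \<lceil>60 * (1 / real (rounds pp) * 2 powr (real (seed_length pp) / 2))\<rceil>"
  unfolding queries_at_most_def
proof (intro ballI allI)
  fix \<omega> t assume "\<omega> \<in> space (stern_space pp)"
  then interpret attacked_world pp "world_of \<omega>" using assms by (intro attacked_world_of)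
  let ?c = "run pp (world_of \<omega>) attack"
  let ?R = "real (rounds pp)"
  obtain t0 where fin: "finished 0 (?c t0)" using attack_run by blast
  have halt: "answer (?c t0) \<noteq> None"
    and q: "queries (?c t0) * rounds pp < budget pp + rounds pp"
    using fin unfolding finished_def by (rule conjunct1, rule conjunct1[OF conjunct2])
  have R: "0 < ?R" using valid by (simp add: valid_params_def)
  have "queries (?c t) \<le> queries (?c t0)"
    using queries_run_mono[of t t0] run_halted[OF halt, of t] by (cases "t \<le> t0") auto
  then have "real (queries (?c t)) * ?R \<le> real (queries (?c t0)) * ?R"
    using R by (intro mult_right_mono) auto
  also have "\<dots> < real (budget pp) + ?R"
    using q by (metis of_nat_add of_nat_less_iff of_nat_mult)
  \<comment> \<open>Dividing by \<open>R\<close> turns the surplus \<open>+ R\<close> of the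
    invariant into one query, and an integer \<open>q\<close> with \<open>q - 1 < x\<close> is at
    most the ceiling of \<open>x\<close>.\<close>
  finally have "real (queries (?c t)) - 1 < real (budget pp) / ?R"
    using R by (simp add: field_simps)
  also have "\<dots> \<le> 60 * (1 / ?R * 2 powr (real (seed_length pp) / 2))"
    using R budget_le[of pp] by (simp add: divide_right_mono field_simps)
  finally have "real_of_int (int (queries (?c t)) - 1) <
      60 * (1 / ?R * 2 powr (real (seed_length pp) / 2))" by simp
  then show "int (queries (?c t)) \<le> \<lceil>60 * (1 / ?R * 2 powr (real (seed_length pp) / 2))\<rceil>"
    unfolding less_ceiling_iff[symmetric] by linarith
qed

lemma finds_key_attack:
  assumes "valid_params pp"
  shows "finds_key_with_prob pp attack ((1 - exp (- 1 / 4)) / 6)"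
proof -
  let ?n = "code_length pp"
  let ?S = "bitstrings (seed_length pp)"
  let ?X = "{\<omega> \<in> space (stern_space pp).
      \<exists>t. answer (run pp (world_of \<omega>) attack t) = Some (DVec (secret (world_of \<omega>)))}"
  let ?M1 = "E0_space pp"
  let ?M2 = "random_function ?S (Perm ?n)"
  let ?M3 = "random_function ?S (carrier_vec ?n :: bit Matrix.vec set)"
  let ?M4 = "random_function (UNIV :: data set) (bitstrings (2 * sec_param pp))"
  let ?M5 = "random_function (UNIV :: bitstring set) (challenges (rounds pp))"
  let ?M6 = "uniform_count_measure (carrier_mat (?n - code_dim pp) ?n :: bit Matrix.mat set)"
  let ?M7 = "uniform_count_measure (words_of_weight ?n (weight pp))"
  let ?M8 = "fresh_space pp"
  have stern: "stern_space pp = ?M1 \<Otimes>\<^sub>M ?M2 \<Otimes>\<^sub>M ?M3 \<Otimes>\<^sub>M ?M4 \<Otimes>\<^sub>M ?M5 \<Otimes>\<^sub>M ?M6 \<Otimes>\<^sub>M ?M7 \<Otimes>\<^sub>M ?M8"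
    by (simp add: stern_space_def Let_def)
  have vec: "(carrier_vec ?n :: bit Matrix.vec set) \<noteq> {}"
    using zero_carrier_vec by blast
  have mat: "(carrier_mat (?n - code_dim pp) ?n :: bit Matrix.mat set) \<noteq> {}"
    using zero_carrier_mat by blast
  have "weight pp \<le> ?n" using assms by (simp add: valid_params_def)
  note words = words_of_weight_nonempty[OF this]
  have p: "prob_space ?M1" "prob_space ?M2" "prob_space ?M3" "prob_space ?M4" "prob_space ?M5"
    "prob_space ?M6" "prob_space ?M7" "prob_space ?M8"
    by (auto intro!: prob_space_random_function prob_space_uniform_count_measure
        simp: finite_bitstrings bitstrings_nonempty finite_Perm Perm_nonempty finite_challenges
        challenges_nonempty finite_carrier_vec_bit finite_carrier_mat_bit finite_words_of_weight
        vec mat words)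
  have R: "0 < rounds pp" using assms by (simp add: valid_params_def)
  have "ennreal (1 / 3) * emeasure (?M1 \<Otimes>\<^sub>M ?M8) (favourable pp) \<le> emeasure (stern_space pp) ?X"
    unfolding stern
  proof (rule emeasure_product8_ge[OF p _ sets_favourable])
    show "{\<omega> \<in> space (?M1 \<Otimes>\<^sub>M ?M2 \<Otimes>\<^sub>M ?M3 \<Otimes>\<^sub>M ?M4 \<Otimes>\<^sub>M ?M5 \<Otimes>\<^sub>M ?M6 \<Otimes>\<^sub>M ?M7 \<Otimes>\<^sub>M ?M8).
        \<exists>t. answer (run pp (world_of \<omega>) attack t) = Some (DVec (secret (world_of \<omega>)))}
      \<in> sets (?M1 \<Otimes>\<^sub>M ?M2 \<Otimes>\<^sub>M ?M3 \<Otimes>\<^sub>M ?M4 \<Otimes>\<^sub>M ?M5 \<Otimes>\<^sub>M ?M6 \<Otimes>\<^sub>M ?M7 \<Otimes>\<^sub>M ?M8)"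
      using sets_success[of pp attack] unfolding stern .
  next
    fix e0 e1 e2 hc M e \<rho>
    assume sp: "e0 \<in> space ?M1" "e1 \<in> space ?M2" "e2 \<in> space ?M3" "hc \<in> space ?M4"
      "M \<in> space ?M6" "e \<in> space ?M7" "\<rho> \<in> space ?M8" and fav: "(e0, \<rho>) \<in> favourable pp"
    \<comment> \<open>\<open>r\<close> is chosen from \<open>e0\<close> and \<open>\<rho>\<close>
      alone, before \<open>hf\<close> is introduced.\<close>
    from fav obtain r where r: "r < budget pp" "\<rho> (round_index pp r) \<in> guesses pp"
      and nfm: "no_false_match pp e0 \<rho>"
      by (auto simp: favourable_def)
    let ?q = "r div rounds pp" and ?j = "r mod rounds pp"
    \<comment> \<open>\<open>undefined\<close> stands in for \<open>Hfs\<close>, which the digest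
      does not read, so \<open>d\<close> is the same point for every \<open>hf\<close>.\<close>
    define d where "d = digest (world_of (e0, e1, e2, hc, undefined, M, e, \<rho>))
      (map (\<lambda>j. \<rho> (?q, j)) [0..<rounds pp])"
    have "ennreal (1 / 3) \<le> emeasure ?M5 {hf \<in> space ?M5. hf d ! ?j = 1}"
      using R by (intro prob_challenge_one) simp
    also have "\<dots> \<le> emeasure ?M5 {hf \<in> space ?M5. (e0, e1, e2, hc, hf, M, e, \<rho>) \<in> ?X}"
    proof (rule emeasure_mono)
      show "{hf \<in> space ?M5. hf d ! ?j = 1} \<subseteq>
          {hf \<in> space ?M5. (e0, e1, e2, hc, hf, M, e, \<rho>) \<in> ?X}"
      proof safe
        fix hf assume hf: "hf \<in> space ?M5" "hf d ! ?j = 1"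
        let ?\<omega> = "(e0, e1, e2, hc, hf, M, e, \<rho>)"
        show \<omega>: "?\<omega> \<in> space (stern_space pp)"
          using sp hf by (simp add: stern space_pair_measure)
        interpret attacked_world pp "world_of ?\<omega>" using assms \<omega> by (rule attacked_world_of)
        have "query_challenges pp (world_of ?\<omega>) ?q = hf d"
          unfolding query_challenges_def d_def
          using digest_cong_Hfs[of e0 e1 e2 hc hf M e \<rho> _ undefined] by simp
        then have "hit pp (world_of ?\<omega>) r"
          using r hf by (simp add: hit_def)
        moreover have "no_false_match pp (E0 (world_of ?\<omega>)) (fresh (world_of ?\<omega>))"
          using nfm by simp
        ultimately show "\<exists>t. answer (run pp (world_of ?\<omega>) attack t) =
            Some (DVec (secret (world_of ?\<omega>)))"
          using attack_run r(1) unfolding finished_def by blast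
      qed
      have "(\<lambda>hf. (e0, e1, e2, hc, hf, M, e, \<rho>)) \<in> measurable ?M5 (stern_space pp)"
        unfolding stern using sp by measurable
      from measurable_sets[OF this sets_success[of pp attack]]
      show "{hf \<in> space ?M5. (e0, e1, e2, hc, hf, M, e, \<rho>) \<in> ?X} \<in> sets ?M5"
        by (simp only: vimage_def Int_def mem_Collect_eq conj_commute)
    qed
    finally show "ennreal (1 / 3) \<le> emeasure ?M5 {hf \<in> space ?M5. (e0, e1, e2, hc, hf, M, e, \<rho>) \<in>
        {\<omega> \<in> space (?M1 \<Otimes>\<^sub>M ?M2 \<Otimes>\<^sub>M ?M3 \<Otimes>\<^sub>M ?M4 \<Otimes>\<^sub>M ?M5 \<Otimes>\<^sub>M ?M6 \<Otimes>\<^sub>M ?M7 \<Otimes>\<^sub>M ?M8).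
        \<exists>t. answer (run pp (world_of \<omega>) attack t) = Some (DVec (secret (world_of \<omega>)))}}"
      unfolding stern .
  qed
  moreover have "ennreal ((1 - exp (- 1 / 4)) / 6) \<le>
      ennreal (1 / 3) * emeasure (?M1 \<Otimes>\<^sub>M ?M8) (favourable pp)"
  proof -
    have "ennreal ((1 - exp (- 1 / 4)) / 6) = ennreal (1 / 3) * ennreal ((1 - exp (- 1 / 4)) / 2)"
      by (subst ennreal_mult[symmetric]) simp_all
    also have "\<dots> \<le> ennreal (1 / 3) * emeasure (?M1 \<Otimes>\<^sub>M ?M8) (favourable pp)"
      by (intro mult_left_mono prob_favourable) simp
    finally show ?thesis .
  qed
  ultimately have "ennreal ((1 - exp (- 1 / 4)) / 6) \<le> emeasure (stern_space pp) ?X"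
    by (rule order_trans[rotated])
  moreover have "prob_space (stern_space pp)"
    unfolding stern by (intro prob_space_pair p)
  ultimately show ?thesis
    unfolding finds_key_with_prob_def
    by (simp add: finite_measure.emeasure_eq_measure prob_space_def)
qed

theorem theorem1:
  shows "(\<exists>A C p. 0 < p \<and>
            (\<forall>pp. valid_params pp \<longrightarrow>
               halts_within pp A (C * 2 powr (real (seed_length pp) / 2)) \<and>
               queries_at_most pp A \<lceil>C * (1 / real (rounds pp) * 2 powr (real (seed_length pp) / 2))\<rceil> \<and>
               finds_key_with_prob pp A p)) \<and>
         preserves_at_most_bits valid_params (\<lambda>pp. real (seed_length pp) / 2) \<and>
         (\<exists>A C p. 0 < p \<and>
            (\<forall>pp. valid_params pp \<and> seed_length pp = sec_param pp \<longrightarrow>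
               halts_within pp A (C * 2 powr (real (sec_param pp) / 2)) \<and>
               finds_key_with_prob pp A p))"
proof -
  have p: "0 < (1 - exp (- 1 / 4 :: real)) / 6" by simp
  \<comment> \<open>The same program, with \<open>C = 60\<close>, witnesses all three parts.\<close>
  note attack_facts = halts_within_attack queries_at_most_attack finds_key_attack
  show ?thesis
  proof (intro conjI)
    show "\<exists>A C p. 0 < p \<and>
            (\<forall>pp. valid_params pp \<longrightarrow>
               halts_within pp A (C * 2 powr (real (seed_length pp) / 2)) \<and>
               queries_at_most pp A \<lceil>C * (1 / real (rounds pp) * 2 powr (real (seed_length pp) / 2))\<rceil> \<and>
               finds_key_with_prob pp A p)"
      using p attack_facts by blast
    show "preserves_at_most_bits valid_params (\<lambda>pp. real (seed_length pp) / 2)"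
      unfolding preserves_at_most_bits_def using p attack_facts by blast
    show "\<exists>A C p. 0 < p \<and>
            (\<forall>pp. valid_params pp \<and> seed_length pp = sec_param pp \<longrightarrow>
               halts_within pp A (C * 2 powr (real (sec_param pp) / 2)) \<and>
               finds_key_with_prob pp A p)"
      using p attack_facts by metis
  qed
qed

end
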